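(* Let $\Bbbk$ be a field with $\operatorname{char}\Bbbk\neq2$, $R=\Bbbk[u_1,\ldots,u_m]$, $\alpha=(\alpha_{ij})\in M_{m\times n}(\Bbbk)$, $u=(u_1,\ldots,u_m)$ and $\alpha_j=(\alpha_{1j},\ldots,\alpha_{mj})$. Consider, for $p=(p_1,\ldots,p_n)\in R^n$, the system $( * )$ consisting of the equations $$p_i(u-\tfrac{\alpha_j}{2})p_j(u-\tfrac{\alpha_i}{2})=p_i(u+\tfrac{\alpha_j}{2})p_j(u+\tfrac{\alpha_i}{2})\quad\forall i\neq j,$$ $$p_k(u-\tfrac{\alpha_i}{2}-\tfrac{\alpha_j}{2})p_k(u+\tfrac{\alpha_i}{2}+\tfrac{\alpha_j}{2})=p_k(u-\tfrac{\alpha_i}{2}+\tfrac{\alpha_j}{2})p_k(u+\tfrac{\alpha_i}{2}-\tfrac{\alpha_j}{2})\quad\forall i\neq j\neq k\neq i.$$ Let $p$ be any monic solution to $( * )$. Then there exists a unique finite subset $$\big\{(\mathcal{O}_1,p^{(1)}),(\mathcal{O}_2,p^{(2)}),\ldots,(\mathcal{O}_k,p^{(k)})\big\}\subseteq(\operatorname{Irr}(R)/\mathbb{Z}^n)\times R^n$$ such that (i) $p=p^{(1)}p^{(2)}\cdots p^{(k)}$ as an equality in the direct product ring $R^n$; (ii) $p^{(i)}$ is a monic solution to $( * )$ for each $i\in\{1,2,\ldots,k\}$; (iii) $p^{(i)}$ is $\mathcal{O}_i$-orbital for each $i\in\{1,2,\ldots,k\}$; (iv) $\mathcal{O}_i\neq\mathcal{O}_j$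 for all $i\neq j$.
   Context: Fix a monomial order on $R$ (e.g. lexicographic); a nonzero polynomial is monic if its leading monomial has coefficient $1$, and $p=(p_1,\ldots,p_n)\in R^n$ is monic if each $p_i$ is nonzero and monic. $\operatorname{Irr}(R)$ is the set of monic irreducible polynomials in $R$. $\sigma_i$ is the $\Bbbk$-algebra automorphism of $R$ with $\sigma_i(u_j)=u_j-\alpha_{ji}$, with square root $\sigma_i^{1/2}$ given by $\sigma_i^{1/2}(u_j)=u_j-\frac12\alpha_{ji}$. The group $\mathbb{Z}^n$ acts on $\operatorname{Irr}(R)$ by $(a_1,\ldots,a_n).q=\sigma_1^{a_1}\circ\cdots\circ\sigma_n^{a_n}(q)$, and $\operatorname{Irr}(R)/\mathbb{Z}^n$ is the set of orbits. For an orbit $\mathcal{O}\in\operatorname{Irr}(R)/\mathbb{Z}^n$, a monic element $p=(p_1,\ldots,p_n)\in R^n$ is $\mathcal{O}$-orbital if for each $i\in\{1,\ldots,n\}$ every (monic) irreducible factor of $p_i$ belongs to $\sigma_i^{1/2}(\mathcal{O})=\{\sigma_i^{1/2}(q)\mid q\in\mathcal{O}\}$.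
   Formalization: The set is also required to contain no pair with p^(i) = (1,…,1): since (1,…,1) is a monic solution that is vacuously orbital for every orbit, uniqueness fails without this (for p = (1,…,1) both the empty set and {(O,1)} satisfy (i)–(iv)). *)

theory Defs
  imports
    "HOL-Analysis.Analysis"
    "HOL-Library.Poly_Mapping"
    "HOL-Computational_Algebra.Factorial_Ring"
begin

text \<open>
  The index sets \<open>{1,\<dots>,m}\<close> and \<open>{1,\<dots>,n}\<close> are finite, linearly ordered types \<open>'m\<close> and \<open>'n\<close>.
  A polynomial over \<open>'k\<close> in the variables \<open>u\<^sub>j\<close> (\<open>j :: 'm\<close>) is a finitely supported map from
  exponent vectors to coefficients; the ring structure is the convolution product of
  \<open>Poly_Mapping\<close>. The ring \<open>R\<^sup>n\<close> is the type \<open>('m, 'k) mpoly ^ 'n\<close>, whose multiplication and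
  unit are componentwise.
\<close>

type_synonym 'm monom = "'m \<Rightarrow>\<^sub>0 nat"
type_synonym ('m, 'k) mpoly = "('m \<Rightarrow>\<^sub>0 nat) \<Rightarrow>\<^sub>0 'k"

definition Const :: "'k \<Rightarrow> ('m, 'k::zero) mpoly" where
  "Const c = Poly_Mapping.single 0 c"

definition Var :: "'m \<Rightarrow> ('m, 'k::zero_neq_one) mpoly" where
  "Var j = Poly_Mapping.single (Poly_Mapping.single j 1) 1"

definition subst :: "('m \<Rightarrow> ('m, 'k) mpoly) \<Rightarrow> ('m::finite, 'k::comm_ring_1) mpoly \<Rightarrow> ('m, 'k) mpoly" where
  "subst f q = (\<Sum>s\<in>Poly_Mapping.keys q.
     Const (Poly_Mapping.lookup q s) * (\<Prod>j\<in>UNIV. f j ^ Poly_Mapping.lookup s j))"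

text \<open>\<open>shift q c\<close> is the polynomial \<open>q(u + c)\<close>.\<close>

definition shift :: "('m::finite, 'k::comm_ring_1) mpoly \<Rightarrow> 'k ^ 'm \<Rightarrow> ('m, 'k) mpoly" where
  "shift q c = subst (\<lambda>j. Var j + Const (c $ j)) q"

text \<open>A relation is read as \<open>(s, t) \<in> ord\<close> iff \<open>s \<le> t\<close>.\<close>

definition monomial_order :: "'m monom rel \<Rightarrow> bool" where
  "monomial_order ord \<longleftrightarrow> linear_order ord \<and> (\<forall>s. (0, s) \<in> ord) \<and>
     (\<forall>s t w. (s, t) \<in> ord \<longrightarrow> (s + w, t + w) \<in> ord)"

definition lead_monom :: "'m monom rel \<Rightarrow> ('m, 'k::zero) mpoly \<Rightarrow> 'm monom" where
  "lead_monom ord q =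
     (THE s. s \<in> Poly_Mapping.keys q \<and> (\<forall>t\<in>Poly_Mapping.keys q. (t, s) \<in> ord))"

definition monic :: "'m monom rel \<Rightarrow> ('m, 'k::zero_neq_one) mpoly \<Rightarrow> bool" where
  "monic ord q \<longleftrightarrow> q \<noteq> 0 \<and> Poly_Mapping.lookup q (lead_monom ord q) = 1"

definition monic_vec :: "'m monom rel \<Rightarrow> ('m, 'k::zero_neq_one) mpoly ^ 'n \<Rightarrow> bool" where
  "monic_vec ord p \<longleftrightarrow> (\<forall>i. monic ord (p $ i))"

definition Irr :: "'m monom rel \<Rightarrow> ('m, 'k::comm_ring_1) mpoly set" where
  "Irr ord = {q. irreducible q \<and> monic ord q}"

definition sigma ::
  "'k::field ^ 'n ^ 'm \<Rightarrow> 'n \<Rightarrow> ('m::finite, 'k) mpoly \<Rightarrow> ('m, 'k) mpoly" where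
  "sigma \<alpha> i q = subst (\<lambda>j. Var j - Const (\<alpha> $ j $ i)) q"

definition sigma_half ::
  "'k::field ^ 'n ^ 'm \<Rightarrow> 'n \<Rightarrow> ('m::finite, 'k) mpoly \<Rightarrow> ('m, 'k) mpoly" where
  "sigma_half \<alpha> i q = subst (\<lambda>j. Var j - Const (1/2 * \<alpha> $ j $ i)) q"

definition int_iterate :: "('a \<Rightarrow> 'a) \<Rightarrow> int \<Rightarrow> 'a \<Rightarrow> 'a" where
  "int_iterate f a = (if a \<ge> 0 then f ^^ nat a else inv f ^^ nat (- a))"

text \<open>\<open>act \<alpha> a = \<sigma>\<^sub>1\<^bsup>a\<^sub>1\<^esup> \<circ> \<dots> \<circ> \<sigma>\<^sub>n\<^bsup>a\<^sub>n\<^esup>\<close>, the factors in increasing order of the index.\<close>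

definition act ::
  "'k::field ^ 'n::{finite,linorder} ^ 'm \<Rightarrow> int ^ 'n::{finite,linorder} \<Rightarrow> ('m::finite, 'k) mpoly \<Rightarrow> ('m, 'k) mpoly" where
  "act \<alpha> a = foldr (\<lambda>i g. int_iterate (sigma \<alpha> i) (a $ i) \<circ> g) (sorted_list_of_set UNIV) id"

definition Irr_orbits ::
  "'m monom rel \<Rightarrow> 'k::field ^ 'n::{finite,linorder} ^ 'm \<Rightarrow> ('m::finite, 'k) mpoly set set" where
  "Irr_orbits ord \<alpha> = {{act \<alpha> a q | a. True} | q. q \<in> Irr ord}"

text \<open>The vector \<open>\<alpha>\<^sub>j\<close> is the column \<open>column j \<alpha>\<close> of the \<open>m \<times> n\<close> matrix \<open>\<alpha>\<close>.\<close>

definition solution ::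
  "'k::field ^ 'n ^ 'm \<Rightarrow> ('m::finite, 'k) mpoly ^ 'n \<Rightarrow> bool" where
  "solution \<alpha> p \<longleftrightarrow> (let h = (\<lambda>j. (1/2) *s column j \<alpha>) in
     (\<forall>i j. i \<noteq> j \<longrightarrow>
        shift (p $ i) (- h j) * shift (p $ j) (- h i) = shift (p $ i) (h j) * shift (p $ j) (h i)) \<and>
     (\<forall>i j k. i \<noteq> j \<and> j \<noteq> k \<and> k \<noteq> i \<longrightarrow>
        shift (p $ k) (- h i - h j) * shift (p $ k) (h i + h j) =
        shift (p $ k) (- h i + h j) * shift (p $ k) (h i - h j)))"

definition orbital ::
  "'m monom rel \<Rightarrow> 'k::field ^ 'n ^ 'm \<Rightarrow> ('m::finite, 'k) mpoly set \<Rightarrow> ('m, 'k) mpoly ^ 'n \<Rightarrow> bool" where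
  "orbital ord \<alpha> \<O> p \<longleftrightarrow> monic_vec ord p \<and>
     (\<forall>i. \<forall>f\<in>Irr ord. f dvd p $ i \<longrightarrow> f \<in> sigma_half \<alpha> i ` \<O>)"

text \<open>
  The constant tuple \<open>1 = (1,\<dots>,1)\<close> is a monic solution and is vacuously orbital for every
  orbit. Hence a pair \<open>(\<O>, 1)\<close> with an unused orbit can always be added to a decomposition, and
  uniqueness of the set of pairs is meant among sets without such trivial pairs: the theorem
  requires \<open>p\<^sup>(\<^sup>i\<^sup>) \<noteq> 1\<close> for all \<open>i\<close>.
\<close>

end

theory Submission
  imports Defs "HOL-Computational_Algebra.Polynomial"
begin

text \<open>
  The polynomial ring is factorial, so each entry \<open>p\<^sub>i\<close> is in a unique way a product of monic
  irreducibles, and the sets \<open>\<sigma>\<^sub>i\<^sup>1\<^sup>/\<^sup>2(\<O>)\<close> partition these into classes. The component of \<open>p\<close> at an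
  orbit \<open>\<O>\<close> collects, for each \<open>i\<close>, the factors of \<open>p\<^sub>i\<close> lying in \<open>\<sigma>\<^sub>i\<^sup>1\<^sup>/\<^sup>2(\<O>)\<close>; by unique
  factorization no other choice is possible. Since \<open>\<O>\<close> is invariant under translation by the
  vectors \<open>\<alpha>\<^sub>j\<close>, all four translates in an equation of the system move the class of \<open>\<O>\<close> to the same
  set of irreducibles, so that comparing the factors in this set yields the equation for the
  component.
\<close>

section \<open>Evaluation homomorphisms\<close>

text \<open>The half translations in the notion of an orbital element are what makes the first
  equation split. With \<open>h j\<close> half of column j of \<alpha>, the class of an orbit O in
  p_i is O moved by \<open>- h i\<close>; in p_i(u - h j) it becomes O moved by
  \<open>- h i - h j\<close>, which is symmetric in i and j and so is also its class in p_j(u - h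
  i). The translates with plus signs differ from this by full columns, which do not move O; here 2
  must be invertible, so that two halves make a column. All identities hold exactly and not just up
  to units, because translations preserve leading monomials and leading coefficients: a monic
  irreducible stays monic, and a monic polynomial has one multiset of monic irreducible factors. The
  main labour is that irreducible polynomials in several variables are prime. The induction on the
  variables takes place inside one type: the subring generated by a set V of variables is a subset
  of the full ring, and primality is tested on elements of this subset. Gauss's lemma is run without
  fractions, by multiplying with leading coefficients and cancelling them afterwards.\<close>

definition is_hom :: "('a::comm_ring_1 \<Rightarrow> 'b::comm_ring_1) \<Rightarrow> bool" where
  "is_hom H \<longleftrightarrow> H 1 = 1 \<and> (\<forall>a b. H (a + b) = H a + H b) \<and> (\<forall>a b. H (a * b) = H a * H b)"

lemma is_hom_one: "is_hom H \<Longrightarrow> H 1 = 1"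
  and is_hom_add: "is_hom H \<Longrightarrow> H (a + b) = H a + H b"
  and is_hom_mult: "is_hom H \<Longrightarrow> H (a * b) = H a * H b"
  by (simp_all add: is_hom_def)

lemma is_hom_zero: "is_hom H \<Longrightarrow> H 0 = 0"
  using is_hom_add[of H 0 0] by simp

lemma is_hom_uminus: "is_hom H \<Longrightarrow> H (- a) = - H a"
  using is_hom_add[of H a "- a"] by (simp add: is_hom_zero eq_neg_iff_add_eq_0 add.commute)

lemma is_hom_diff: "is_hom H \<Longrightarrow> H (a - b) = H a - H b"
  using is_hom_add[of H a "- b"] by (simp add: is_hom_uminus)

lemma is_hom_prod: "is_hom H \<Longrightarrow> H (prod f A) = (\<Prod>x\<in>A. H (f x))"
  by (induction A rule: infinite_finite_induct) (simp_all add: is_hom_one is_hom_mult)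

lemma is_hom_power: "is_hom H \<Longrightarrow> H (a ^ n) = H a ^ n"
  by (induction n) (simp_all add: is_hom_one is_hom_mult)

lemma is_hom_dvd: "is_hom H \<Longrightarrow> a dvd b \<Longrightarrow> H a dvd H b"
  by (auto simp: dvd_def is_hom_mult)

lemma is_hom_comp: "is_hom G \<Longrightarrow> is_hom H \<Longrightarrow> is_hom (\<lambda>x. G (H x))"
  by (simp add: is_hom_def)

lemma is_hom_id: "is_hom (\<lambda>x. x)"
  by (simp add: is_hom_def)

text \<open>The homomorphism given by the universal property of the polynomial ring. The coefficient
  map is a parameter because the target varies: \<open>subst\<close> is the instance with
  \<open>Const\<close>, while \<open>to_poly\<close> maps into univariate polynomials.\<close>

definition insertion ::
  "('k::comm_ring_1 \<Rightarrow> 'b::comm_ring_1) \<Rightarrow> ('m::finite \<Rightarrow> 'b) \<Rightarrow> ('m, 'k) mpoly \<Rightarrow> 'b" where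
  "insertion \<phi> f q = (\<Sum>s\<in>Poly_Mapping.keys q.
     \<phi> (Poly_Mapping.lookup q s) * (\<Prod>j\<in>UNIV. f j ^ Poly_Mapping.lookup s j))"

lemma subst_eq_insertion: "subst f = insertion Const f"
  by (rule ext) (simp add: subst_def insertion_def)

lemma mpoly_eq_sum_single:
  "q = (\<Sum>s\<in>Poly_Mapping.keys q. Poly_Mapping.single s (Poly_Mapping.lookup q s))"
  by (rule poly_mapping_eqI)
    (auto simp: lookup_sum lookup_single when_def sum.delta in_keys_iff)

lemma mpoly_induct [case_names single add]:
  fixes q :: "('m, 'k::comm_ring_1) mpoly"
  assumes "\<And>s c. P (Poly_Mapping.single s c)" "\<And>a b. P a \<Longrightarrow> P b \<Longrightarrow> P (a + b)"
  shows "P q"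
proof -
  have "P (\<Sum>s\<in>A. Poly_Mapping.single s (Poly_Mapping.lookup q s))" if "finite A" for A
    using that
  proof (induction A)
    case empty
    show ?case using assms(1)[of 0 0] by simp
  qed (simp add: assms)
  then show ?thesis
    by (subst mpoly_eq_sum_single) simp
qed

text \<open>Terms may cancel in a sum, so its support can be smaller than the union of the two
  supports. Additivity is read off over a common superset, where the extra terms vanish.\<close>

lemma insertion_superset:
  assumes "is_hom \<phi>" "finite A" "Poly_Mapping.keys q \<subseteq> A"
  shows "insertion \<phi> f q = (\<Sum>s\<in>A.
     \<phi> (Poly_Mapping.lookup q s) * (\<Prod>j\<in>UNIV. f j ^ Poly_Mapping.lookup s j))"
  unfolding insertion_def
  by (rule sum.mono_neutral_left) (use assms in \<open>auto simp: in_keys_iff is_hom_zero\<close>)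

lemma insertion_single:
  "is_hom \<phi> \<Longrightarrow> insertion \<phi> f (Poly_Mapping.single s c) =
     \<phi> c * (\<Prod>j\<in>UNIV. f j ^ Poly_Mapping.lookup s j)"
  by (subst insertion_superset[where A = "{s}"]) auto

lemma insertion_add:
  assumes "is_hom \<phi>"
  shows "insertion \<phi> f (a + b) = insertion \<phi> f a + insertion \<phi> f b"
proof -
  let ?A = "Poly_Mapping.keys a \<union> Poly_Mapping.keys b"
  have "Poly_Mapping.keys (a + b) \<subseteq> ?A" by (rule keys_add)
  then show ?thesis
    by (simp add: insertion_superset[OF assms, of ?A] lookup_add is_hom_add[OF assms]
        distrib_right sum.distrib)
qed

lemma insertion_mult:
  assumes "is_hom \<phi>"
  shows "insertion \<phi> f (a * b) = insertion \<phi> f a * insertion \<phi> f b"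
proof (induction a rule: mpoly_induct)
  case (single s c)
  show ?case
  proof (induction b rule: mpoly_induct)
    case (single t d)
    show ?case
      by (simp add: mult_single insertion_single[OF assms] is_hom_mult[OF assms] lookup_add
          power_add prod.distrib mult_ac)
  qed (simp add: distrib_left insertion_add[OF assms])
qed (simp add: distrib_right insertion_add[OF assms])

lemma is_hom_insertion: "is_hom \<phi> \<Longrightarrow> is_hom (insertion \<phi> f)"
  unfolding is_hom_def[of "insertion \<phi> f"]
  using insertion_single[of \<phi> f 0 1] by (simp add: insertion_add insertion_mult is_hom_one)

lemma insertion_Const: "is_hom \<phi> \<Longrightarrow> insertion \<phi> f (Const c) = \<phi> c"
  by (simp add: Const_def insertion_single)

lemma insertion_Var:
  fixes f :: "'m::finite \<Rightarrow> _"
  assumes "is_hom \<phi>"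
  shows "insertion \<phi> f (Var x) = f x"
proof -
  have "insertion \<phi> f (Var x) = (\<Prod>j\<in>UNIV. if j = x then f j else 1)"
    unfolding Var_def insertion_single[OF assms] is_hom_one[OF assms] mult_1_left
    by (rule prod.cong) (auto simp: lookup_single when_def)
  then show ?thesis by simp
qed

lemma is_hom_Const: "is_hom (Const :: 'k::comm_ring_1 \<Rightarrow> ('m, 'k) mpoly)"
  by (simp add: is_hom_def Const_def single_add mult_single)

lemma Var_power: "Var x ^ n = Poly_Mapping.single (Poly_Mapping.single x n) (1::'k::comm_ring_1)"
  unfolding Var_def
  by (induction n) (simp_all add: mult_single single_add[symmetric])

lemma prod_single:
  "(\<Prod>j\<in>A. Poly_Mapping.single (g j) (1::'k::comm_ring_1)) = Poly_Mapping.single (\<Sum>j\<in>A. g j) 1"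
  for g :: "'i \<Rightarrow> 'm \<Rightarrow>\<^sub>0 nat"
  by (induction A rule: infinite_finite_induct) (simp_all add: mult_single)

lemma monom_eq_sum: "s = (\<Sum>j\<in>UNIV. Poly_Mapping.single j (Poly_Mapping.lookup s j))"
  for s :: "'m::finite \<Rightarrow>\<^sub>0 nat"
  by (rule poly_mapping_eqI) (simp add: lookup_sum lookup_single when_def)

lemma single_eq_Const_Var:
  "Poly_Mapping.single s c = Const c * (\<Prod>j\<in>UNIV. Var j ^ Poly_Mapping.lookup s j)"
  for c :: "'k::comm_ring_1" and s :: "'m::finite \<Rightarrow>\<^sub>0 nat"
  by (simp add: Var_power prod_single monom_eq_sum[symmetric] Const_def mult_single)

text \<open>Every polynomial is a sum of products of constants and variables. This reduces the
  composition law for translations and \<open>poly_to_poly\<close> to checks on generators.\<close>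

lemma is_hom_eqI:
  fixes G H :: "('m::finite, 'k::comm_ring_1) mpoly \<Rightarrow> 'b::comm_ring_1"
  assumes "is_hom G" "is_hom H" "\<And>c. G (Const c) = H (Const c)" "\<And>j. G (Var j) = H (Var j)"
  shows "G q = H q"
proof (induction q rule: mpoly_induct)
  case (single s c)
  show ?case
    by (simp add: single_eq_Const_Var assms is_hom_mult is_hom_prod is_hom_power)
qed (simp add: assms is_hom_add)

section \<open>Translations\<close>

lemma is_hom_shift: "is_hom (\<lambda>q. shift q c)"
  unfolding shift_def subst_eq_insertion by (rule is_hom_insertion[OF is_hom_Const])

lemmas shift_add = is_hom_add[OF is_hom_shift]
  and shift_mult = is_hom_mult[OF is_hom_shift]
  and shift_one [simp] = is_hom_one[OF is_hom_shift]
  and shift_zero [simp] = is_hom_zero[OF is_hom_shift]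

lemma shift_Const: "shift (Const a) c = Const a"
  by (simp add: shift_def subst_eq_insertion insertion_Const is_hom_Const)

lemma shift_Var: "shift (Var j) c = Var j + Const (c $ j)"
  by (simp add: shift_def subst_eq_insertion insertion_Var is_hom_Const)

lemma shift_by_0 [simp]: "shift q 0 = q"
  by (rule is_hom_eqI[OF is_hom_shift is_hom_id])
    (simp_all add: shift_Const shift_Var is_hom_zero[OF is_hom_Const])

lemma shift_shift: "shift (shift q c) d = shift q (c + d)"
  by (rule is_hom_eqI[OF is_hom_comp[OF is_hom_shift is_hom_shift] is_hom_shift])
    (simp_all add: shift_Const shift_Var shift_add is_hom_add[OF is_hom_Const] add_ac)

lemma shift_inj: "shift p c = shift q c \<longleftrightarrow> p = q"
proof
  assume "shift p c = shift q c"
  then have "shift (shift p c) (- c) = shift (shift q c) (- c)" by simp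
  then show "p = q" by (simp add: shift_shift)
qed simp

lemma shift_dvd_iff: "shift p c dvd shift q c \<longleftrightarrow> p dvd q"
proof
  assume "shift p c dvd shift q c"
  from is_hom_dvd[OF is_hom_shift this, of "- c"] show "p dvd q" by (simp add: shift_shift)
qed (rule is_hom_dvd[OF is_hom_shift])

lemma irreducible_shift: "irreducible (shift q c) \<longleftrightarrow> irreducible q"
proof -
  have "irreducible (shift q c)" if "irreducible q" for q :: "('m::finite, 'k::comm_ring_1) mpoly" and c
  proof (rule irreducibleI)
    show "shift q c \<noteq> 0"
      using that shift_inj[of q c 0] by auto
    show "\<not> shift q c dvd 1"
      using that shift_dvd_iff[of q c 1] irreducible_not_unit by auto
    fix a b assume "shift q c = a * b"
    then have "shift (shift q c) (- c) = shift a (- c) * shift b (- c)"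
      by (simp add: shift_mult)
    then have "q = shift a (- c) * shift b (- c)"
      by (simp add: shift_shift)
    with that have "shift a (- c) dvd 1 \<or> shift b (- c) dvd 1"
      by (auto dest: irreducibleD)
    then show "a dvd 1 \<or> b dvd 1"
      using shift_dvd_iff[of a "- c" 1] shift_dvd_iff[of b "- c" 1] by simp
  qed
  from this[of q c] this[of "shift q c" "- c"] show ?thesis
    by (auto simp: shift_shift)
qed

section \<open>Unique factorization\<close>

text \<open>The coefficients do not involve \<open>x\<close> but keep the type of polynomials in all
  variables, so the passage to univariate polynomials can be repeated for one variable after
  another.\<close>

definition to_poly :: "'m \<Rightarrow> ('m::finite, 'k::comm_ring_1) mpoly \<Rightarrow> ('m, 'k) mpoly poly" where
  "to_poly x = insertion (\<lambda>c. [:Const c:]) (\<lambda>j. if j = x then [:0, 1:] else [:Var j:])"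

lemma is_hom_const_poly: "is_hom (\<lambda>c::'a::comm_ring_1. [:c:])"
  by (simp add: is_hom_def one_pCons)

lemma is_hom_to_poly: "is_hom (to_poly x)"
  unfolding to_poly_def
  by (rule is_hom_insertion[OF is_hom_comp[OF is_hom_const_poly is_hom_Const]])

lemmas to_poly_add = is_hom_add[OF is_hom_to_poly]
  and to_poly_mult = is_hom_mult[OF is_hom_to_poly]
  and to_poly_diff = is_hom_diff[OF is_hom_to_poly]
  and to_poly_power = is_hom_power[OF is_hom_to_poly]
  and to_poly_one [simp] = is_hom_one[OF is_hom_to_poly]
  and to_poly_zero [simp] = is_hom_zero[OF is_hom_to_poly]

lemma to_poly_Const: "to_poly x (Const c) = [:Const c:]"
  unfolding to_poly_def by (rule insertion_Const[OF is_hom_comp[OF is_hom_const_poly is_hom_Const]])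

lemma to_poly_Var: "to_poly x (Var j) = (if j = x then [:0, 1:] else [:Var j:])"
  unfolding to_poly_def by (rule insertion_Var[OF is_hom_comp[OF is_hom_const_poly is_hom_Const]])

lemma is_hom_poly: "is_hom (\<lambda>p. poly p a)"
  by (simp add: is_hom_def)

text \<open>This left inverse makes \<open>to_poly\<close> injective and pulls divisibility back
  from univariate polynomials.\<close>

lemma poly_to_poly: "poly (to_poly x q) (Var x) = q"
  by (rule is_hom_eqI[OF is_hom_comp[OF is_hom_poly is_hom_to_poly] is_hom_id])
    (simp_all add: to_poly_Const to_poly_Var)

lemma to_poly_eq_0_iff [simp]: "to_poly x q = 0 \<longleftrightarrow> q = 0"
  using poly_to_poly[of x q] by auto

lemma monom_split: "s - Poly_Mapping.single x (Poly_Mapping.lookup s x) +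
    Poly_Mapping.single x (Poly_Mapping.lookup s x) = s"
  for s :: "'m \<Rightarrow>\<^sub>0 nat"
  by (rule poly_mapping_eqI) (simp add: lookup_add lookup_minus lookup_single when_def)

lemma to_poly_single:
  "to_poly x (Poly_Mapping.single s c) =
     monom (Poly_Mapping.single (s - Poly_Mapping.single x (Poly_Mapping.lookup s x)) c)
       (Poly_Mapping.lookup s x)"
proof -
  let ?t = "s - Poly_Mapping.single x (Poly_Mapping.lookup s x)"
  have t: "Poly_Mapping.lookup ?t x = 0"
    by (simp add: lookup_minus)
  have "to_poly x (Poly_Mapping.single ?t c) =
      [:Const c:] * (\<Prod>j\<in>UNIV. to_poly x (Var j) ^ Poly_Mapping.lookup ?t j)"
    by (simp add: single_eq_Const_Var to_poly_mult is_hom_prod[OF is_hom_to_poly] to_poly_Const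
        to_poly_power)
  also have "(\<Prod>j\<in>UNIV. to_poly x (Var j) ^ Poly_Mapping.lookup ?t j) =
      (\<Prod>j\<in>UNIV. [:Var j ^ Poly_Mapping.lookup ?t j:])"
    by (rule prod.cong) (auto simp: to_poly_Var t is_hom_power[OF is_hom_const_poly] one_pCons)
  also have "[:Const c:] * \<dots> = [:Poly_Mapping.single ?t c:]"
    by (simp add: is_hom_prod[OF is_hom_const_poly, symmetric] single_eq_Const_Var[of ?t])
  finally have 1: "to_poly x (Poly_Mapping.single ?t c) = [:Poly_Mapping.single ?t c:]" .
  have "to_poly x (Poly_Mapping.single s c) =
      to_poly x (Poly_Mapping.single ?t c * Var x ^ Poly_Mapping.lookup s x)"
    by (simp add: Var_power mult_single monom_split)
  also have "\<dots> = [:Poly_Mapping.single ?t c:] * monom 1 (Poly_Mapping.lookup s x)"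
    by (simp add: to_poly_mult 1 to_poly_power to_poly_Var monom_altdef)
  finally show ?thesis by (simp add: smult_monom)
qed

text \<open>A coefficient never involves \<open>x\<close> itself, which accounts for the value 0 at
  monomials containing \<open>x\<close>.\<close>

lemma lookup_coeff_to_poly:
  "Poly_Mapping.lookup (coeff (to_poly x q) n) t =
     (if Poly_Mapping.lookup t x = 0 then Poly_Mapping.lookup q (t + Poly_Mapping.single x n) else 0)"
proof (induction q rule: mpoly_induct)
  case (single s c)
  have "s = t + Poly_Mapping.single x n \<longleftrightarrow>
      Poly_Mapping.lookup s x = n \<and> s - Poly_Mapping.single x (Poly_Mapping.lookup s x) = t"
    if "Poly_Mapping.lookup t x = 0"
  proof
    assume "s = t + Poly_Mapping.single x n"
    then show "Poly_Mapping.lookup s x = n \<and>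
        s - Poly_Mapping.single x (Poly_Mapping.lookup s x) = t"
      by (simp add: lookup_add that)
  next
    assume "Poly_Mapping.lookup s x = n \<and>
        s - Poly_Mapping.single x (Poly_Mapping.lookup s x) = t"
    then show "s = t + Poly_Mapping.single x n"
      using monom_split[of s x, symmetric] by blast
  qed
  moreover have "Poly_Mapping.lookup (s - Poly_Mapping.single x (Poly_Mapping.lookup s x)) x = 0"
    by (simp add: lookup_minus)
  ultimately show ?case
    by (auto simp: to_poly_single lookup_single when_def)
qed (simp add: to_poly_add lookup_add)

section \<open>Degrees in one variable and subrings generated by some of the variables\<close>

abbreviation deg :: "'m \<Rightarrow> ('m::finite, 'k::comm_ring_1) mpoly \<Rightarrow> nat" where
  "deg x q \<equiv> Polynomial.degree (to_poly x q)"

lemma deg_eq_0_iff: "deg x q = 0 \<longleftrightarrow> (\<forall>s\<in>Poly_Mapping.keys q. Poly_Mapping.lookup s x = 0)"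
proof
  assume d: "deg x q = 0"
  show "\<forall>s\<in>Poly_Mapping.keys q. Poly_Mapping.lookup s x = 0"
  proof
    fix s assume s: "s \<in> Poly_Mapping.keys q"
    let ?n = "Poly_Mapping.lookup s x"
    let ?t = "s - Poly_Mapping.single x ?n"
    have "Poly_Mapping.lookup (coeff (to_poly x q) ?n) ?t \<noteq> 0"
      using s by (simp add: lookup_coeff_to_poly lookup_minus in_keys_iff monom_split)
    then have "coeff (to_poly x q) ?n \<noteq> 0" by auto
    from le_degree[OF this] show "?n = 0" using d by simp
  qed
next
  assume 0: "\<forall>s\<in>Poly_Mapping.keys q. Poly_Mapping.lookup s x = 0"
  have "coeff (to_poly x q) n = 0" if "n > 0" for n
  proof (rule poly_mapping_eqI)
    fix t
    have "t + Poly_Mapping.single x n \<notin> Poly_Mapping.keys q"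
      using 0 that by (auto simp: lookup_add)
    then show "Poly_Mapping.lookup (coeff (to_poly x q) n) t = Poly_Mapping.lookup 0 t"
      by (simp add: lookup_coeff_to_poly in_keys_iff)
  qed
  then have "deg x q \<le> 0" by (intro degree_le) blast
  then show "deg x q = 0" by simp
qed

lemma to_poly_eq_const:
  assumes "deg x q = 0"
  shows "to_poly x q = [:q:]"
proof -
  obtain c where c: "to_poly x q = [:c:]" using assms by (metis degree_eq_zeroE)
  with poly_to_poly[of x q] show ?thesis by simp
qed

text \<open>The linear order on the variables makes the polynomial type an integral domain, so
  leading coefficients in \<open>x\<close> cannot multiply to 0.\<close>

lemma deg_mult:
  "a \<noteq> 0 \<Longrightarrow> b \<noteq> 0 \<Longrightarrow> deg x (a * b) = deg x a + deg x b"
  for a b :: "('m::{finite,linorder}, 'k::idom) mpoly"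
  by (simp add: to_poly_mult degree_mult_eq)

text \<open>This is the subring k[V]. Phrasing membership by degrees gives closure under products
  and, over a domain, under divisors of nonzero elements.\<close>

definition polys_in :: "'m set \<Rightarrow> ('m::finite, 'k::comm_ring_1) mpoly set" where
  "polys_in V = {q. \<forall>x. x \<notin> V \<longrightarrow> deg x q = 0}"

lemma polys_in_deg: "q \<in> polys_in V \<Longrightarrow> x \<notin> V \<Longrightarrow> deg x q = 0"
  by (simp add: polys_in_def)

lemma polys_in_UNIV [simp]: "q \<in> polys_in UNIV"
  by (simp add: polys_in_def)

lemma polys_in_mono: "V \<subseteq> W \<Longrightarrow> q \<in> polys_in V \<Longrightarrow> q \<in> polys_in W"
  by (auto simp: polys_in_def)

lemma polys_in_zero [simp]: "0 \<in> polys_in V"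
  by (simp add: polys_in_def)

lemma polys_in_one [simp]: "1 \<in> polys_in V"
  by (simp add: polys_in_def)

lemma polys_inI: "(\<And>x. x \<notin> V \<Longrightarrow> deg x q \<le> 0) \<Longrightarrow> q \<in> polys_in V"
  by (simp add: polys_in_def)

lemma polys_in_add: "a \<in> polys_in V \<Longrightarrow> b \<in> polys_in V \<Longrightarrow> a + b \<in> polys_in V"
  by (rule polys_inI, unfold to_poly_add, rule degree_add_le) (simp_all add: polys_in_deg)

lemma polys_in_diff: "a \<in> polys_in V \<Longrightarrow> b \<in> polys_in V \<Longrightarrow> a - b \<in> polys_in V"
  by (rule polys_inI, unfold to_poly_diff, rule degree_diff_le) (simp_all add: polys_in_deg)

lemma polys_in_mult: "a \<in> polys_in V \<Longrightarrow> b \<in> polys_in V \<Longrightarrow> a * b \<in> polys_in V"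
  by (rule polys_inI, unfold to_poly_mult, rule order_trans[OF degree_mult_le])
    (simp add: polys_in_deg)

lemma polys_in_power: "a \<in> polys_in V \<Longrightarrow> a ^ n \<in> polys_in V"
  by (induction n) (simp_all add: polys_in_mult)

lemma polys_in_Var: "x \<in> V \<Longrightarrow> Var x \<in> polys_in V"
  by (auto simp: polys_in_def to_poly_Var)

lemma polys_in_multD:
  fixes a b :: "('m::{finite,linorder}, 'k::idom) mpoly"
  assumes "a * b \<in> polys_in V" "a * b \<noteq> 0"
  shows "a \<in> polys_in V"
  using assms by (auto simp: polys_in_def deg_mult)

lemma coeff_to_poly_in:
  assumes "q \<in> polys_in (insert x V)"
  shows "coeff (to_poly x q) n \<in> polys_in V"
  unfolding polys_in_def deg_eq_0_iff
proof safe
  fix y s assume y: "y \<notin> V" and s: "s \<in> Poly_Mapping.keys (coeff (to_poly x q) n)"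
  have sx: "Poly_Mapping.lookup s x = 0"
    and q: "s + Poly_Mapping.single x n \<in> Poly_Mapping.keys q"
    using s by (auto simp: in_keys_iff lookup_coeff_to_poly split: if_splits)
  show "Poly_Mapping.lookup s y = 0"
  proof (cases "y = x")
    case False
    with y assms have "deg y q = 0" by (auto simp: polys_in_def)
    then show ?thesis using q by (auto simp: deg_eq_0_iff lookup_add)
  qed (simp add: sx)
qed

lemma eq_Const_if_deg_0:
  assumes "\<And>x. deg x q = 0"
  shows "q = Const (Poly_Mapping.lookup q 0)"
proof -
  have "s = 0" if "s \<in> Poly_Mapping.keys q" for s
    using assms that by (intro poly_mapping_eqI) (auto simp: deg_eq_0_iff)
  then show ?thesis
    by (intro poly_mapping_eqI) (auto simp: Const_def lookup_single when_def in_keys_iff)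
qed

lemma is_unit_iff_deg:
  fixes q :: "('m::{finite,linorder}, 'k::field) mpoly"
  assumes "q \<noteq> 0"
  shows "q dvd 1 \<longleftrightarrow> (\<forall>x. deg x q = 0)"
proof
  assume "q dvd 1"
  then obtain r where "1 = q * r" by (auto elim: dvdE)
  then show "\<forall>x. deg x q = 0"
    using deg_mult[of q r] assms by (metis add_is_0 degree_1 mult_zero_right to_poly_one zero_neq_one)
next
  assume 0: "\<forall>x. deg x q = 0"
  then obtain c where c: "q = Const c" using eq_Const_if_deg_0 by blast
  with assms have "c \<noteq> 0" by (auto simp: is_hom_zero[OF is_hom_Const])
  then have "q * Const (inverse c) = 1"
    by (simp add: c is_hom_mult[OF is_hom_Const, symmetric] is_hom_one[OF is_hom_Const])
  then show "q dvd 1" by (metis dvdI)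
qed

text \<open>The sum of the degrees in the single variables, not the largest degree of a monomial. It
  is additive on products and, over a field, 0 exactly at the units among the nonzero elements, so
  it drops when passing to a proper divisor.\<close>

definition total_deg :: "('m::finite, 'k::comm_ring_1) mpoly \<Rightarrow> nat" where
  "total_deg q = (\<Sum>x\<in>UNIV. deg x q)"

lemma total_deg_mult:
  "a \<noteq> 0 \<Longrightarrow> b \<noteq> 0 \<Longrightarrow> total_deg (a * b) = total_deg a + total_deg b"
  for a b :: "('m::{finite,linorder}, 'k::idom) mpoly"
  by (simp add: total_deg_def deg_mult sum.distrib)

lemma is_unit_iff_total_deg:
  "q \<noteq> 0 \<Longrightarrow> q dvd 1 \<longleftrightarrow> total_deg q = 0"
  for q :: "('m::{finite,linorder}, 'k::field) mpoly"
  by (simp add: total_deg_def is_unit_iff_deg)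

lemma irreducible_divisor_exists:
  fixes q :: "('m::{finite,linorder}, 'k::field) mpoly"
  assumes "q \<noteq> 0" "\<not> q dvd 1"
  shows "\<exists>f. irreducible f \<and> f dvd q"
  using assms
proof (induction "total_deg q" arbitrary: q rule: less_induct)
  case less
  show ?case
  proof (cases "irreducible q")
    case False
    then obtain a b where ab: "q = a * b" "\<not> a dvd 1" "\<not> b dvd 1"
      using less.prems by (auto simp: irreducible_def)
    with less.prems have "total_deg a < total_deg q"
      by (auto simp: total_deg_mult is_unit_iff_total_deg)
    with ab less.prems obtain f where "irreducible f" "f dvd a"
      using less.hyps[of a] by auto
    with ab show ?thesis by auto
  qed auto
qed

section \<open>Gauss's lemma and pseudo-division\<close>

lemma const_dvd_iff_coeffs:
  fixes c q :: "('m::{finite,linorder}, 'k::idom) mpoly"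
  assumes "deg x c = 0"
  shows "c dvd q \<longleftrightarrow> (\<forall>n. c dvd coeff (to_poly x q) n)"
proof
  assume "c dvd q"
  from is_hom_dvd[OF is_hom_to_poly this, of x] show "\<forall>n. c dvd coeff (to_poly x q) n"
    unfolding to_poly_eq_const[OF assms] const_poly_dvd_iff .
next
  assume "\<forall>n. c dvd coeff (to_poly x q) n"
  then have "[:c:] dvd to_poly x q" by (simp add: const_poly_dvd_iff)
  from is_hom_dvd[OF is_hom_poly this, of "Var x"] show "c dvd q"
    by (simp add: poly_to_poly)
qed

text \<open>The least coefficients of \<open>p\<close> and \<open>q\<close> not divisible by \<open>c\<close> multiply to a coefficient of
  \<open>p * q\<close>, up to multiples of \<open>c\<close>.\<close>

lemma gauss_coeffs:
  fixes p q :: "'a::comm_ring_1 poly"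
  assumes dvd: "\<And>n. c dvd coeff (p * q) n"
    and prime: "\<And>i j. c dvd coeff p i * coeff q j \<Longrightarrow> c dvd coeff p i \<or> c dvd coeff q j"
  shows "(\<forall>n. c dvd coeff p n) \<or> (\<forall>n. c dvd coeff q n)"
proof (rule ccontr)
  assume "\<not> ?thesis"
  then have ex: "\<exists>n. \<not> c dvd coeff p n" "\<exists>n. \<not> c dvd coeff q n" by auto
  define i j where "i = (LEAST n. \<not> c dvd coeff p n)" and "j = (LEAST n. \<not> c dvd coeff q n)"
  have i: "\<not> c dvd coeff p i" and j: "\<not> c dvd coeff q j"
    unfolding i_def j_def by (rule LeastI_ex[OF ex(1)], rule LeastI_ex[OF ex(2)])
  have less: "k < i \<Longrightarrow> c dvd coeff p k" "k < j \<Longrightarrow> c dvd coeff q k" for k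
    unfolding i_def j_def by (auto dest: not_less_Least)
  have "c dvd (\<Sum>k\<in>{..i + j} - {i}. coeff p k * coeff q (i + j - k))"
  proof (rule dvd_sum)
    fix k assume "k \<in> {..i + j} - {i}"
    then have "k < i \<or> i + j - k < j" by auto
    then show "c dvd coeff p k * coeff q (i + j - k)" using less by auto
  qed
  moreover have "coeff (p * q) (i + j) =
      coeff p i * coeff q j + (\<Sum>k\<in>{..i + j} - {i}. coeff p k * coeff q (i + j - k))"
    unfolding coeff_mult by (subst sum.remove[of _ i]) auto
  ultimately have "c dvd coeff p i * coeff q j"
    using dvd[of "i + j"] by (simp add: dvd_add_left_iff)
  with prime i j show False by blast
qed

text \<open>Divisibility is meant in the full ring; only the two test factors are confined to
  \<open>V\<close>. For a nonzero non-unit and \<open>V = UNIV\<close> this is primality.\<close>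

definition prime_in :: "'m set \<Rightarrow> ('m::finite, 'k::comm_ring_1) mpoly \<Rightarrow> bool" where
  "prime_in V f \<longleftrightarrow> (\<forall>g\<in>polys_in V. \<forall>h\<in>polys_in V. f dvd g * h \<longrightarrow> f dvd g \<or> f dvd h)"

lemma prime_inD:
  "prime_in V f \<Longrightarrow> g \<in> polys_in V \<Longrightarrow> h \<in> polys_in V \<Longrightarrow> f dvd g * h \<Longrightarrow> f dvd g \<or> f dvd h"
  unfolding prime_in_def by blast

text \<open>As \<open>f\<close> is free of \<open>x\<close>, it divides a polynomial iff it divides
  all coefficients in \<open>x\<close>. These lie in k[V], where \<open>f\<close> is prime, so
  \<open>gauss_coeffs\<close> applies.\<close>

lemma prime_in_insert:
  fixes f :: "('m::{finite,linorder}, 'k::idom) mpoly"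
  assumes "prime_in V f" "f \<in> polys_in V" "x \<notin> V"
  shows "prime_in (insert x V) f"
  unfolding prime_in_def
proof (intro ballI impI)
  fix g h assume gh: "g \<in> polys_in (insert x V)" "h \<in> polys_in (insert x V)" "f dvd g * h"
  have f: "deg x f = 0" by (rule polys_in_deg[OF assms(2,3)])
  have "(\<forall>n. f dvd coeff (to_poly x g) n) \<or> (\<forall>n. f dvd coeff (to_poly x h) n)"
  proof (rule gauss_coeffs)
    show "f dvd coeff (to_poly x g * to_poly x h) n" for n
      using gh(3) unfolding const_dvd_iff_coeffs[OF f, of "g * h"] to_poly_mult by blast
    show "f dvd coeff (to_poly x g) i \<or> f dvd coeff (to_poly x h) j"
      if "f dvd coeff (to_poly x g) i * coeff (to_poly x h) j" for i j
      by (rule prime_inD[OF assms(1) coeff_to_poly_in coeff_to_poly_in that]; fact gh)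
  qed
  then show "f dvd g \<or> f dvd h"
    by (simp only: const_dvd_iff_coeffs[OF f, of g] const_dvd_iff_coeffs[OF f, of h])
qed

text \<open>The irreducible factors of \<open>c\<close> are removed one at a time. Each is prime, so
  in an equation \<open>c * s = d * q\<close> it divides \<open>d\<close>, and is then moved into
  \<open>e\<close>, or divides \<open>q\<close> and is cancelled. Once \<open>c\<close> has become a
  unit, what remains of \<open>d\<close> divides \<open>s\<close>.\<close>

lemma cancel_coefficient:
  fixes c d s :: "('m::{finite,linorder}, 'k::field) mpoly"
  assumes "\<And>f :: ('m, 'k) mpoly.
      f \<in> polys_in V \<Longrightarrow> irreducible f \<Longrightarrow> prime_in (insert x V) f"
    and "c \<in> polys_in V" "c \<noteq> 0" "s \<noteq> 0" "s \<in> polys_in (insert x V)" "d dvd c * s"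
  shows "\<exists>e d'. e \<in> polys_in V \<and> e \<noteq> 0 \<and> d = e * d' \<and> d' dvd s"
  using assms(2-)
proof (induction "total_deg c" arbitrary: c d rule: less_induct)
  case less
  show ?case
  proof (cases "c dvd 1")
    case True
    from mult_dvd_mono[OF this dvd_refl, of s] have "d dvd s"
      using dvd_trans[OF less.prems(5)] by simp
    then show ?thesis by (intro exI[of _ 1] exI[of _ d]) simp
  next
    case False
    then obtain f where f: "irreducible f" "f dvd c"
      using irreducible_divisor_exists less.prems by blast
    then obtain c' where c': "c = f * c'" by auto
    have nz: "f \<noteq> 0" "c' \<noteq> 0" using c' less.prems by auto
    have fV: "f \<in> polys_in V" "c' \<in> polys_in V"
      using polys_in_multD[of f c' V] polys_in_multD[of c' f V] c' less.prems
      by (auto simp: mult.commute)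
    have small: "total_deg c' < total_deg c"
      using c' nz f(1) irreducible_not_unit[of f]
      by (auto simp: total_deg_mult is_unit_iff_total_deg)
    obtain q where q: "c * s = d * q" using less.prems(5) by auto
    have nz': "d * q \<noteq> 0" using less.prems by (simp flip: q)
    have "c * s \<in> polys_in (insert x V)"
      using less.prems polys_in_mono[of V "insert x V"] by (intro polys_in_mult) auto
    then have "d \<in> polys_in (insert x V)" "q \<in> polys_in (insert x V)"
      using polys_in_multD[of d q] polys_in_multD[of q d] nz' q by (auto simp: mult.commute)
    moreover have "f dvd d * q" by (simp flip: q add: c' mult.assoc)
    ultimately have "f dvd d \<or> f dvd q"
      by (intro prime_inD[OF assms(1)[OF fV(1) f(1)]])
    then show ?thesis
    proof
      assume "f dvd d"
      then obtain d1 where d1: "d = f * d1" by auto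
      then have "f * (c' * s) = f * (d1 * q)" using q c' by (simp add: mult_ac)
      then have "d1 dvd c' * s" using nz by auto
      from less.hyps[OF small fV(2) nz(2) less.prems(3,4) this]
      obtain e d' where "e \<in> polys_in V" "e \<noteq> 0" "d1 = e * d'" "d' dvd s" by blast
      then show ?thesis using d1 fV nz
        by (intro exI[of _ "f * e"] exI[of _ d']) (auto simp: polys_in_mult mult_ac)
    next
      assume "f dvd q"
      then obtain q1 where q1: "q = f * q1" by auto
      then have "f * (c' * s) = f * (d * q1)" using q c' by (simp add: mult_ac)
      then have "d dvd c' * s" using nz by auto
      from less.hyps[OF small fV(2) nz(2) less.prems(3,4) this] show ?thesis .
    qed
  qed
qed

text \<open>Write \<open>f = e * f'\<close> with \<open>e\<close> free of \<open>x\<close> and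
  \<open>f'\<close> dividing \<open>s\<close>. By irreducibility one of the two is a unit; it cannot
  be \<open>f'\<close>, since then \<open>f\<close> would lie in k[V].\<close>

lemma irreducible_dvd_cancel_coefficient:
  fixes f c s :: "('m::{finite,linorder}, 'k::field) mpoly"
  assumes "\<And>f :: ('m, 'k) mpoly.
      f \<in> polys_in V \<Longrightarrow> irreducible f \<Longrightarrow> prime_in (insert x V) f"
    and "c \<in> polys_in V" "c \<noteq> 0" "s \<in> polys_in (insert x V)"
    and "irreducible f" "f \<notin> polys_in V" "f dvd c * s"
  shows "f dvd s"
proof (cases "s = 0")
  case False
  obtain e f' where e: "e \<in> polys_in V" "e \<noteq> 0" "f = e * f'" "f' dvd s"
    using cancel_coefficient[OF assms(1-3) False assms(4,7)] by auto
  from irreducibleD[OF assms(5) e(3)] have "e dvd 1"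
  proof
    assume u: "f' dvd 1"
    have "f' \<noteq> 0" using u by auto
    then have "f' \<in> polys_in V" using u by (auto simp: is_unit_iff_deg polys_in_def)
    with e have "f \<in> polys_in V" by (simp add: polys_in_mult)
    with assms(6) show ?thesis by simp
  qed
  from mult_dvd_mono[OF this dvd_refl, of f'] have "f dvd f'" by (simp add: e)
  then show ?thesis using e(4) by (rule dvd_trans)
qed simp

text \<open>Both products have the same coefficient at the power \<open>deg x p\<close> of
  \<open>x\<close>, namely the product of the two leading coefficients, and it cancels. The case
  \<open>r = 0\<close> is excluded because its degree 0 need not be below that of
  \<open>p\<close>.\<close>

lemma pseudo_remainder_smaller:
  fixes p d :: "('m::{finite,linorder}, 'k::field) mpoly"
  assumes "d \<noteq> 0" "deg x d \<le> deg x p"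
    and "r = lead_coeff (to_poly x d) * p - lead_coeff (to_poly x p) * Var x ^ (deg x p - deg x d) * d"
    and "deg x (lead_coeff (to_poly x d)) = 0" "deg x (lead_coeff (to_poly x p)) = 0" "r \<noteq> 0"
  shows "deg x r < deg x p"
proof -
  let ?n = "deg x p" and ?m = "deg x d"
  let ?P = "to_poly x p" and ?D = "to_poly x d"
  have r: "to_poly x r = smult (lead_coeff ?D) ?P - smult (lead_coeff ?P) (monom 1 (?n - ?m) * ?D)"
    by (simp add: assms(3) to_poly_diff to_poly_mult to_poly_power to_poly_Var monom_altdef
        to_poly_eq_const[OF assms(4)] to_poly_eq_const[OF assms(5)])
  have "coeff (to_poly x r) ?n = 0"
    using assms(2) by (simp add: r coeff_monom_mult)
  moreover have "deg x r \<le> ?n"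
    unfolding r
    by (rule degree_diff_le; rule order_trans[OF degree_smult_le])
      (use assms(2) in \<open>auto intro!: order_trans[OF degree_mult_le] simp: degree_monom_eq\<close>)
  moreover have "lead_coeff (to_poly x r) \<noteq> 0"
    using assms(6) by simp
  ultimately show ?thesis
    by (cases "deg x r = ?n") auto
qed

text \<open>Gauss's lemma for a single variable \<open>x\<close>. For irreducible \<open>f\<close> of positive degree in \<open>x\<close>, an
  element \<open>d\<close> of least degree in the ideal generated by \<open>f\<close> and \<open>g\<close> divides \<open>f\<close> and \<open>g\<close> up to
  factors free of \<open>x\<close>; so \<open>d\<close> is either such a factor itself or a multiple of \<open>f\<close>.\<close>

lemma prime_in_step:
  fixes f :: "('m::{finite,linorder}, 'k::field) mpoly"
  assumes IH: "\<And>f :: ('m, 'k) mpoly. f \<in> polys_in V \<Longrightarrow> irreducible f \<Longrightarrow> prime_in V f"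
    and x: "x \<notin> V"
    and f: "f \<in> polys_in (insert x V)" "irreducible f"
  shows "prime_in (insert x V) f"
proof (cases "f \<in> polys_in V")
  case True
  with IH[OF this f(2)] x show ?thesis by (intro prime_in_insert)
next
  case False
  let ?W = "insert x V"
  have VW: "q \<in> polys_in V \<Longrightarrow> q \<in> polys_in ?W" for q :: "('m, 'k) mpoly"
    by (rule polys_in_mono[of V]) auto
  have prime: "prime_in ?W f" if "f \<in> polys_in V" "irreducible f" for f :: "('m, 'k) mpoly"
    using IH that x by (intro prime_in_insert) auto
  note cancel = irreducible_dvd_cancel_coefficient[OF prime _ _ _ f(2) False]
  have f0: "f \<noteq> 0" using f(2) by auto
  show ?thesis
    unfolding prime_in_def
  proof (intro ballI impI)
    fix g h assume g: "g \<in> polys_in ?W" and h: "h \<in> polys_in ?W" and dvd: "f dvd g * h"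
    define J where "J = {a * f + b * g | a b. a \<in> polys_in ?W \<and> b \<in> polys_in ?W}"
    have JW: "j \<in> polys_in ?W" if "j \<in> J" for j
      using that f g by (auto simp: J_def intro: polys_in_add polys_in_mult)
    have J_mult: "c * j \<in> J" if "j \<in> J" "c \<in> polys_in ?W" for c j
    proof -
      from that obtain a b where "j = a * f + b * g" "a \<in> polys_in ?W" "b \<in> polys_in ?W"
        by (auto simp: J_def)
      with that have "c * j = (c * a) * f + (c * b) * g" "c * a \<in> polys_in ?W" "c * b \<in> polys_in ?W"
        by (auto simp: algebra_simps polys_in_mult)
      then show ?thesis by (auto simp: J_def)
    qed
    have J_diff: "i - j \<in> J" if "i \<in> J" "j \<in> J" for i j
    proof -
      from that obtain a b a' b' where
        "i = a * f + b * g" "a \<in> polys_in ?W" "b \<in> polys_in ?W"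
        "j = a' * f + b' * g" "a' \<in> polys_in ?W" "b' \<in> polys_in ?W"
        by (auto simp: J_def)
      then have "i - j = (a - a') * f + (b - b') * g" "a - a' \<in> polys_in ?W" "b - b' \<in> polys_in ?W"
        by (auto simp: algebra_simps polys_in_diff)
      then show ?thesis by (auto simp: J_def)
    qed
    have fJ: "f \<in> J" and gJ: "g \<in> J"
      unfolding J_def
      by (intro CollectI exI[of _ 1] exI[of _ 0]; simp) (intro CollectI exI[of _ 0] exI[of _ 1]; simp)
    \<comment> \<open>This is how the hypothesis on \<open>g * h\<close> enters: it extends from
      \<open>g\<close> to every element of the ideal.\<close>
    have dvdJ: "f dvd j * h" if "j \<in> J" for j
      using that dvd by (auto simp: J_def algebra_simps)
    obtain d where d: "d \<in> J" "d \<noteq> 0" and d_min: "\<And>j. j \<in> J \<Longrightarrow> j \<noteq> 0 \<Longrightarrow> deg x d \<le> deg x j"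
      using arg_min_nat_lemma[of "\<lambda>j. j \<in> J \<and> j \<noteq> 0" f "deg x"] fJ f0 by blast
    let ?l = "lead_coeff (to_poly x d)"
    have l: "?l \<in> polys_in V" "?l \<noteq> 0"
      using coeff_to_poly_in[OF JW[OF d(1)]] d(2) by simp_all
    \<comment> \<open>Minimality keeps the degree of \<open>d\<close> at most that of any nonzero
      element of \<open>J\<close>, so pseudo-division can go on until the remainder is 0. The
      factors \<open>?l\<close> collected on the way form \<open>c\<close>.\<close>
    have pseudo: "\<exists>c\<in>polys_in V. c \<noteq> 0 \<and> d dvd c * j" if "j \<in> J" for j
      using that
    proof (induction "deg x j" arbitrary: j rule: less_induct)
      case less
      define r where "r = ?l * j - lead_coeff (to_poly x j) * Var x ^ (deg x j - deg x d) * d"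
      have lj: "lead_coeff (to_poly x j) \<in> polys_in V"
        by (rule coeff_to_poly_in[OF JW[OF less.prems]])
      have rJ: "r \<in> J" unfolding r_def
        by (intro J_diff J_mult less.prems d VW l polys_in_mult lj polys_in_power polys_in_Var) auto
      show ?case
      proof (cases "j = 0 \<or> r = 0")
        case True
        then show ?thesis
        proof
          assume "r = 0"
          then have "d dvd ?l * j" by (auto simp: r_def)
          with l show ?thesis by blast
        qed (auto intro: bexI[of _ 1])
      next
        case False
        then have "deg x r < deg x j"
          by (intro pseudo_remainder_smaller[OF d(2) _ r_def])
            (use d_min[OF less.prems] l lj x in \<open>auto simp: polys_in_def\<close>)
        from less.hyps[OF this rJ] obtain c where c: "c \<in> polys_in V" "c \<noteq> 0" "d dvd c * r" by blast
        have "c * ?l * j = c * r + c * lead_coeff (to_poly x j) * Var x ^ (deg x j - deg x d) * d"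
          by (simp add: r_def algebra_simps)
        with c have "d dvd c * ?l * j" by simp
        with c l show ?thesis by (intro bexI[of _ "c * ?l"]) (auto simp: polys_in_mult)
      qed
    qed
    obtain c where c: "c \<in> polys_in V" "c \<noteq> 0" "d dvd c * f" using pseudo[OF fJ] by blast
    obtain e d' where e: "e \<in> polys_in V" "e \<noteq> 0" "d = e * d'" "d' dvd f"
      using cancel_coefficient[OF prime c(1,2) f0 f(1) c(3)] by blast
    from e(4) obtain q where q: "f = d' * q" by auto
    from irreducibleD[OF f(2) q] show "f dvd g \<or> f dvd h"
    proof
      assume "d' dvd 1"
      \<comment> \<open>Up to a unit \<open>d\<close> is \<open>e\<close>, which lies in k[V] and
        can be cancelled; this leaves \<open>f dvd h\<close>.\<close>
      have "f dvd d * h" by (rule dvdJ[OF d(1)])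
      also have "d * h dvd e * h"
        using mult_dvd_mono[OF dvd_refl \<open>d' dvd 1\<close>, of "e * h"] by (simp add: e(3) mult_ac)
      finally show ?thesis using cancel[OF _ _ e(1,2) h] by blast
    next
      assume "q dvd 1"
      then have "f dvd d'" using mult_dvd_mono[OF dvd_refl, of q 1 d'] q by simp
      obtain c' where c': "c' \<in> polys_in V" "c' \<noteq> 0" "d dvd c' * g" using pseudo[OF gJ] by blast
      have "f dvd c' * g" 
        using \<open>f dvd d'\<close> by (intro dvd_trans[OF _ c'(3)]) (simp add: e(3))
      then show ?thesis using cancel[OF _ _ c'(1,2) g] by blast
    qed
  qed
qed

text \<open>Induction on the set of variables. Over the empty set every nonzero element is a
  constant, hence a unit, so there is no irreducible to treat; the last set is
  \<open>UNIV\<close>.\<close>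

theorem irreducible_imp_prime_elem:
  fixes f :: "('m::{finite,linorder}, 'k::field) mpoly"
  assumes "irreducible f"
  shows "prime_elem f"
proof -
  have "prime_in V f" if "finite V" "f \<in> polys_in V" "irreducible f"
    for V and f :: "('m, 'k) mpoly"
    using that
  proof (induction V arbitrary: f)
    case empty
    then have "f \<noteq> 0" by auto
    with empty have "f dvd 1"
      by (simp add: is_unit_iff_deg polys_in_def)
    with empty show ?case by (auto dest: irreducible_not_unit)
  next
    case (insert x V)
    then show ?case by (intro prime_in_step) auto
  qed
  from this[of UNIV f] assms show ?thesis
    by (auto simp: prime_elem_def prime_in_def irreducible_not_unit)
qed

section \<open>Monic polynomials\<close>

text \<open>A relational form of \<open>lead_monom\<close>, free of the definite description;
  \<open>lead_monom_eqI\<close> connects the two.\<close>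

definition is_lead :: "'m monom rel \<Rightarrow> ('m, 'k::zero) mpoly \<Rightarrow> 'm monom \<Rightarrow> bool" where
  "is_lead ord q s \<longleftrightarrow> s \<in> Poly_Mapping.keys q \<and> (\<forall>t\<in>Poly_Mapping.keys q. (t, s) \<in> ord)"

lemma lookup_mult_keys:
  fixes a b :: "('m, 'k::comm_ring_1) mpoly"
  shows "Poly_Mapping.lookup (a * b) w =
    (\<Sum>s\<in>Poly_Mapping.keys a. \<Sum>t\<in>Poly_Mapping.keys b.
      if s + t = w then Poly_Mapping.lookup a s * Poly_Mapping.lookup b t else 0)"
proof -
  have "a * b = (\<Sum>s\<in>Poly_Mapping.keys a. Poly_Mapping.single s (Poly_Mapping.lookup a s)) *
      (\<Sum>t\<in>Poly_Mapping.keys b. Poly_Mapping.single t (Poly_Mapping.lookup b t))"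
    by (simp flip: mpoly_eq_sum_single)
  also have "\<dots> = (\<Sum>s\<in>Poly_Mapping.keys a. \<Sum>t\<in>Poly_Mapping.keys b.
      Poly_Mapping.single (s + t) (Poly_Mapping.lookup a s * Poly_Mapping.lookup b t))"
    by (simp add: sum_product mult_single)
  finally show ?thesis
    by (simp add: lookup_sum lookup_single when_def)
qed

lemma lookup_Const_mult:
  "Poly_Mapping.lookup (Const c * q) s = c * Poly_Mapping.lookup q s"
  for q :: "('m, 'k::comm_ring_1) mpoly"
  by (induction q rule: mpoly_induct)
    (simp_all add: Const_def mult_single lookup_single when_def distrib_left lookup_add)

text \<open>Naming the leading monomial lets it be tracked through products, where leading monomials
  add.\<close>

definition monic_at :: "'m monom rel \<Rightarrow> ('m, 'k::zero_neq_one) mpoly \<Rightarrow> 'm monom \<Rightarrow> bool" where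
  "monic_at ord q s \<longleftrightarrow> is_lead ord q s \<and> Poly_Mapping.lookup q s = 1"

text \<open>Normalizing the factors to be monic selects one associate each, so for monic
  \<open>q\<close> there is exactly one such multiset.\<close>

definition factors :: "'m monom rel \<Rightarrow> ('m, 'k::field) mpoly \<Rightarrow> ('m, 'k) mpoly multiset" where
  "factors ord q = (THE A. set_mset A \<subseteq> Irr ord \<and> prod_mset A = q)"

definition irr_part ::
  "'m monom rel \<Rightarrow> ('m, 'k::field) mpoly set \<Rightarrow> ('m, 'k) mpoly \<Rightarrow> ('m, 'k) mpoly" where
  "irr_part ord T q = prod_mset (filter_mset (\<lambda>f. f \<in> T) (factors ord q))"

context
  fixes ord :: "'m::{finite,linorder} monom rel"
  assumes ord: "monomial_order ord"
begin

lemma ord_refl: "(s, s) \<in> ord"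
  and ord_trans: "(s, t) \<in> ord \<Longrightarrow> (t, u) \<in> ord \<Longrightarrow> (s, u) \<in> ord"
  and ord_antisym: "(s, t) \<in> ord \<Longrightarrow> (t, s) \<in> ord \<Longrightarrow> s = t"
  and ord_total: "(s, t) \<in> ord \<or> (t, s) \<in> ord"
  and ord_zero: "(0, s) \<in> ord"
  and ord_add_right: "(s, t) \<in> ord \<Longrightarrow> (s + u, t + u) \<in> ord"
  and ord_add_left: "(s, t) \<in> ord \<Longrightarrow> (u + s, u + t) \<in> ord"
proof -
  have "linear_order ord" and rest: "\<And>s. (0, s) \<in> ord" "\<And>s t u. (s, t) \<in> ord \<Longrightarrow> (s + u, t + u) \<in> ord"
    using ord unfolding monomial_order_def by blast+
  then have lin: "refl ord" "trans ord" "antisym ord" "total ord"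
    by (auto simp: linear_order_on_def partial_order_on_def preorder_on_def)
  show refl: "(s, s) \<in> ord" using lin(1) by (rule reflD)
  show "(s, t) \<in> ord \<Longrightarrow> (t, u) \<in> ord \<Longrightarrow> (s, u) \<in> ord" using lin(2) by (rule transD)
  show "(s, t) \<in> ord \<Longrightarrow> (t, s) \<in> ord \<Longrightarrow> s = t" using lin(3) by (rule antisymD)
  show "(s, t) \<in> ord \<or> (t, s) \<in> ord" using lin(4) refl unfolding total_on_def by (cases "s = t") auto
  show "(0, s) \<in> ord" by (rule rest(1))
  show "(s, t) \<in> ord \<Longrightarrow> (s + u, t + u) \<in> ord" by (rule rest(2))
  show "(s, t) \<in> ord \<Longrightarrow> (u + s, u + t) \<in> ord" using rest(2)[of s t u] by (simp add: add.commute)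
qed

lemma ord_add_mono: "(s, t) \<in> ord \<Longrightarrow> (u, v) \<in> ord \<Longrightarrow> (s + u, t + v) \<in> ord"
  using ord_trans[OF ord_add_right ord_add_left] by blast

text \<open>Because of this, the sum of two leading monomials arises from only one pair of
  monomials, and no cancellation occurs in \<open>is_lead_mult\<close>.\<close>

lemma ord_add_eqD:
  assumes "(s, t) \<in> ord" "(u, v) \<in> ord" "s + u = t + v"
  shows "s = t \<and> u = v"
proof -
  have "(t + u, s + u) \<in> ord" "(s + u, t + u) \<in> ord"
    using assms ord_add_left[of u v t] ord_add_right[of s t u] by auto
  then have "s + u = t + u" by (rule ord_antisym[symmetric])
  with assms(3) show ?thesis by simp
qed

lemma is_lead_unique: "is_lead ord q s \<Longrightarrow> is_lead ord q t \<Longrightarrow> s = t"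
  unfolding is_lead_def by (blast intro: ord_antisym)

lemma lead_monom_eqI: "is_lead ord q s \<Longrightarrow> lead_monom ord q = s"
  unfolding lead_monom_def using is_lead_unique[unfolded is_lead_def]
  by (intro the_equality) (auto simp: is_lead_def)

lemma is_lead_exists:
  assumes "q \<noteq> 0"
  shows "\<exists>s. is_lead ord q s"
proof -
  have "\<exists>s\<in>A. \<forall>t\<in>A. (t, s) \<in> ord" if "finite A" "A \<noteq> {}" for A
    using that
  proof (induction A rule: finite_ne_induct)
    case (singleton x)
    then show ?case by (simp add: ord_refl)
  next
    case (insert x A)
    then obtain s where s: "s \<in> A" "\<forall>t\<in>A. (t, s) \<in> ord" by blast
    show ?case
    proof (cases "(x, s) \<in> ord")
      case True
      with s show ?thesis by blast
    next
      case False
      then have "(s, x) \<in> ord" using ord_total by blast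
      then have "\<forall>t\<in>A. (t, x) \<in> ord" using s ord_trans by blast
      then show ?thesis by (simp add: ord_refl)
    qed
  qed
  from this[of "Poly_Mapping.keys q"] assms show ?thesis
    unfolding is_lead_def by (simp add: Bex_def)
qed

lemma is_lead_mult:
  fixes a b :: "('m, 'k::idom) mpoly"
  assumes "is_lead ord a s" "is_lead ord b t"
  shows "is_lead ord (a * b) (s + t)"
    and "Poly_Mapping.lookup (a * b) (s + t) = Poly_Mapping.lookup a s * Poly_Mapping.lookup b t"
proof -
  have "Poly_Mapping.lookup (a * b) (s + t) =
    (\<Sum>u\<in>Poly_Mapping.keys a. \<Sum>v\<in>Poly_Mapping.keys b.
      if u = s \<and> v = t then Poly_Mapping.lookup a s * Poly_Mapping.lookup b t else 0)"
    unfolding lookup_mult_keys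
    by (intro sum.cong refl) (use assms ord_add_eqD in \<open>auto simp: is_lead_def\<close>)
  also have "\<dots> = (\<Sum>u\<in>Poly_Mapping.keys a. if u = s then Poly_Mapping.lookup a s * Poly_Mapping.lookup b t else 0)"
    by (intro sum.cong refl) (use assms in \<open>auto simp: is_lead_def\<close>)
  finally show *: "Poly_Mapping.lookup (a * b) (s + t) =
      Poly_Mapping.lookup a s * Poly_Mapping.lookup b t"
    using assms by (simp add: is_lead_def)
  show "is_lead ord (a * b) (s + t)"
    unfolding is_lead_def
  proof
    show "s + t \<in> Poly_Mapping.keys (a * b)"
      using assms by (auto simp: in_keys_iff * is_lead_def)
    show "\<forall>w\<in>Poly_Mapping.keys (a * b). (w, s + t) \<in> ord"
      using keys_mult[of a b] assms by (fastforce simp: is_lead_def intro: ord_add_mono)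
  qed
qed

lemma monic_iff: "monic ord q \<longleftrightarrow> (\<exists>s. monic_at ord q s)"
proof
  assume m: "monic ord q"
  then obtain s where s: "is_lead ord q s" using is_lead_exists unfolding monic_def by blast
  with m show "\<exists>s. monic_at ord q s"
    by (auto simp: monic_def monic_at_def lead_monom_eqI[OF s])
next
  assume "\<exists>s. monic_at ord q s"
  then obtain s where s: "is_lead ord q s" "Poly_Mapping.lookup q s = 1" by (auto simp: monic_at_def)
  then show "monic ord q"
    by (auto simp: monic_def lead_monom_eqI[OF s(1)])
qed

lemma monic_at_one: "monic_at ord (1 :: ('m, 'k::idom) mpoly) 0"
  by (simp add: monic_at_def is_lead_def ord_refl)

lemma monic_at_mult: "monic_at ord a s \<Longrightarrow> monic_at ord b t \<Longrightarrow> monic_at ord (a * b) (s + t)"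
  for a b :: "('m, 'k::idom) mpoly"
  unfolding monic_at_def using is_lead_mult[of a s b t] by simp

lemma monic_at_prod: "(\<And>j. j \<in> A \<Longrightarrow> monic_at ord (f j) (g j)) \<Longrightarrow> monic_at ord (prod f A) (sum g A)"
  for f :: "'i \<Rightarrow> ('m, 'k::idom) mpoly"
  by (induction A rule: infinite_finite_induct) (simp_all add: monic_at_one monic_at_mult)

lemma monic_at_power: "monic_at ord a (Poly_Mapping.single j 1) \<Longrightarrow> monic_at ord (a ^ n) (Poly_Mapping.single j n)"
  for a :: "('m, 'k::idom) mpoly"
proof (induction n)
  case (Suc n)
  then show ?case
    using monic_at_mult[of a "Poly_Mapping.single j 1" "a ^ n" "Poly_Mapping.single j n"]
    by (simp flip: single_add)
qed (simp add: monic_at_one)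

lemma monic_at_Var_plus_Const: "monic_at ord (Var j + Const c :: ('m, 'k::idom) mpoly) (Poly_Mapping.single j 1)"
  unfolding monic_at_def is_lead_def
proof (intro conjI ballI)
  have ne: "Poly_Mapping.single j (1::nat) \<noteq> 0" by (metis lookup_single_eq lookup_zero zero_neq_one)
  then show 1: "Poly_Mapping.lookup (Var j + Const c :: ('m, 'k) mpoly) (Poly_Mapping.single j 1) = 1"
    by (auto simp: Var_def Const_def lookup_add lookup_single when_def)
  then show "Poly_Mapping.single j 1 \<in> Poly_Mapping.keys (Var j + Const c :: ('m, 'k) mpoly)"
    by (simp add: in_keys_iff)
  fix t assume "t \<in> Poly_Mapping.keys (Var j + Const c :: ('m, 'k) mpoly)"
  then have "t = Poly_Mapping.single j 1 \<or> t = 0"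
    by (auto simp: in_keys_iff Var_def Const_def lookup_add lookup_single when_def split: if_splits)
  then show "(t, Poly_Mapping.single j 1) \<in> ord" by (auto simp: ord_refl ord_zero)
qed

text \<open>A translation turns the monomial with exponent t into a product of factors
  \<open>Var j + Const (c $ j)\<close>. The monomial 1 is the least one, so this product is monic
  with leading monomial t. Monomials strictly below s thus contribute nothing at s.\<close>

lemma is_lead_shift:
  fixes q :: "('m, 'k::idom) mpoly"
  assumes "is_lead ord q s"
  shows "is_lead ord (shift q c) s" "Poly_Mapping.lookup (shift q c) s = Poly_Mapping.lookup q s"
proof -
  define T where "T t = (\<Prod>j\<in>UNIV. (Var j + Const (c $ j) :: ('m, 'k) mpoly) ^ Poly_Mapping.lookup t j)" for t
  have T: "monic_at ord (T t) t" for t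
    using monic_at_prod[of UNIV, OF monic_at_power[OF monic_at_Var_plus_Const]]
    unfolding T_def by (subst monom_eq_sum[of t])
  have shift: "shift q c = (\<Sum>t\<in>Poly_Mapping.keys q. Const (Poly_Mapping.lookup q t) * T t)"
    by (simp add: shift_def subst_def T_def)
  have lookup: "Poly_Mapping.lookup (shift q c) u =
      (\<Sum>t\<in>Poly_Mapping.keys q. Poly_Mapping.lookup q t * Poly_Mapping.lookup (T t) u)" for u
    by (simp add: shift lookup_sum lookup_Const_mult)
  have "Poly_Mapping.lookup q t * Poly_Mapping.lookup (T t) s =
      (if t = s then Poly_Mapping.lookup q s else 0)" if "t \<in> Poly_Mapping.keys q" for t
  proof (cases "t = s")
    case True
    then show ?thesis using T[of s] by (simp add: monic_at_def)
  next
    case False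
    have "(t, s) \<in> ord" using that assms by (simp add: is_lead_def)
    then have "(s, t) \<notin> ord" using False ord_antisym by blast
    then have "Poly_Mapping.lookup (T t) s = 0"
      using T[of t] by (auto simp: monic_at_def is_lead_def in_keys_iff)
    then show ?thesis using False by simp
  qed
  then show *: "Poly_Mapping.lookup (shift q c) s = Poly_Mapping.lookup q s"
    unfolding lookup using assms by (simp add: is_lead_def)
  show "is_lead ord (shift q c) s"
    unfolding is_lead_def
  proof (intro conjI ballI)
    show "s \<in> Poly_Mapping.keys (shift q c)"
      using * assms by (simp add: is_lead_def in_keys_iff)
    fix u assume "u \<in> Poly_Mapping.keys (shift q c)"
    then have "Poly_Mapping.lookup (shift q c) u \<noteq> 0" by (simp add: in_keys_iff)
    then obtain t where t: "t \<in> Poly_Mapping.keys q" "Poly_Mapping.lookup (T t) u \<noteq> 0"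
      unfolding lookup by (metis (no_types, lifting) mult_zero_right sum.neutral)
    then have "(u, t) \<in> ord" using T[of t] by (auto simp: monic_at_def is_lead_def in_keys_iff)
    moreover have "(t, s) \<in> ord" using t assms by (simp add: is_lead_def)
    ultimately show "(u, s) \<in> ord" by (rule ord_trans)
  qed
qed

lemma monic_shift: "monic ord q \<Longrightarrow> monic ord (shift q c)"
  for q :: "('m, 'k::idom) mpoly"
  unfolding monic_iff monic_at_def using is_lead_shift by metis

lemma monic_one [simp]: "monic ord (1 :: ('m, 'k::idom) mpoly)"
  using monic_at_one unfolding monic_iff by blast

lemma monic_mult: "monic ord a \<Longrightarrow> monic ord b \<Longrightarrow> monic ord (a * b)"
  for a b :: "('m, 'k::idom) mpoly"
  unfolding monic_iff using monic_at_mult by blast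

lemma monic_multD:
  fixes a b :: "('m, 'k::idom) mpoly"
  assumes "monic ord a" "monic ord (a * b)"
  shows "monic ord b"
proof -
  have "b \<noteq> 0" using assms(2) by (auto simp: monic_def)
  then obtain t where t: "is_lead ord b t" using is_lead_exists by blast
  obtain s where s: "monic_at ord a s" using assms(1) monic_iff by blast
  obtain u where u: "monic_at ord (a * b) u" using assms(2) monic_iff by blast
  have "u = s + t"
    using is_lead_unique u is_lead_mult(1)[of a s b t] s t unfolding monic_at_def by blast
  then have "monic_at ord b t"
    using u s t is_lead_mult(2)[of a s b t] by (simp add: monic_at_def)
  then show ?thesis unfolding monic_iff by blast
qed

lemma monic_associate_exists:
  fixes q :: "('m, 'k::field) mpoly"
  assumes "q \<noteq> 0"
  shows "\<exists>c. c \<noteq> 0 \<and> monic ord (Const c * q)"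
proof -
  obtain s where s: "is_lead ord q s" using is_lead_exists assms by blast
  then have nz: "Poly_Mapping.lookup q s \<noteq> 0" by (simp add: is_lead_def in_keys_iff)
  let ?c = "inverse (Poly_Mapping.lookup q s)"
  have "monic_at ord (Const ?c * q) s"
    using s nz by (auto simp: monic_at_def is_lead_def in_keys_iff lookup_Const_mult)
  with nz show ?thesis unfolding monic_iff by (intro exI[of _ ?c]) auto
qed

lemma monic_unit:
  fixes q :: "('m, 'k::field) mpoly"
  assumes "monic ord q" "q dvd 1"
  shows "q = 1"
proof -
  have nz: "q \<noteq> 0" using assms(1) by (simp add: monic_def)
  with assms(2) have c: "q = Const (Poly_Mapping.lookup q 0)"
    by (intro eq_Const_if_deg_0) (simp add: is_unit_iff_deg)
  obtain s where s: "monic_at ord q s" using assms(1) monic_iff by blast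
  have "s = 0"
    using s by (subst (asm) c) (auto simp: monic_at_def is_lead_def Const_def split: if_splits)
  with s have "Poly_Mapping.lookup q 0 = 1" by (simp add: monic_at_def)
  with c show ?thesis by (simp add: Const_def)
qed

section \<open>Factorization into monic irreducibles\<close>

lemma Irr_nonzero: "f \<in> Irr ord \<Longrightarrow> f \<noteq> 0"
  and Irr_not_unit: "f \<in> Irr ord \<Longrightarrow> \<not> f dvd 1"
  by (auto simp: Irr_def irreducible_not_unit)

lemma Irr_dvd_imp_eq:
  fixes f g :: "('m, 'k::field) mpoly"
  assumes "f \<in> Irr ord" "g \<in> Irr ord" "f dvd g"
  shows "f = g"
proof -
  obtain u where u: "g = f * u" using assms(3) by auto
  have "u dvd 1"
    using irreducibleD[of g f u] u assms Irr_not_unit by (auto simp: Irr_def)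
  moreover have "monic ord u" using monic_multD[of f u] u assms by (auto simp: Irr_def)
  ultimately show ?thesis using u monic_unit[of u] by simp
qed

text \<open>Primality gives an element of \<open>A\<close> divisible by \<open>f\<close>; between
  monic irreducibles, divisibility is equality.\<close>

lemma Irr_dvd_prod_mset:
  fixes f :: "('m, 'k::field) mpoly"
  assumes "f \<in> Irr ord" "set_mset A \<subseteq> Irr ord" "f dvd prod_mset A"
  shows "f \<in># A"
proof -
  have "prime_elem f" using assms(1) by (auto simp: Irr_def intro: irreducible_imp_prime_elem)
  then have "\<exists>g\<in>#A. f dvd g"
    using assms(3) by (induction A) (auto simp: prime_elem_dvd_mult_iff prime_elem_not_unit)
  then obtain g where "g \<in># A" "f dvd g" by blast
  with assms Irr_dvd_imp_eq[of f g] show ?thesis by auto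
qed

lemma Irr_factorization_unique:
  fixes A B :: "('m, 'k::field) mpoly multiset"
  assumes "set_mset A \<subseteq> Irr ord" "set_mset B \<subseteq> Irr ord" "prod_mset A = prod_mset B"
  shows "A = B"
  using assms
proof (induction A arbitrary: B)
  case empty
  have "B = {#}"
  proof (rule ccontr)
    assume "B \<noteq> {#}"
    then obtain f where f: "f \<in># B" by (auto simp: multiset_nonemptyE)
    then have "f dvd 1" using empty.prems(3) dvd_prod_mset[OF f] by simp
    with f empty.prems(2) Irr_not_unit show False by auto
  qed
  then show ?case by simp
next
  case (add f A)
  have f: "f \<in> Irr ord" using add.prems by simp
  have "f \<in># B"
    using add.prems by (intro Irr_dvd_prod_mset f) (auto simp flip: add.prems(3))
  then obtain C where C: "B = add_mset f C" by (auto dest: multi_member_split)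
  have "prod_mset A = prod_mset C"
    using add.prems(3) Irr_nonzero[OF f] by (simp add: C)
  with add.IH[of C] add.prems C show ?case by simp
qed

lemma Irr_factorization_exists:
  fixes q :: "('m, 'k::field) mpoly"
  assumes "monic ord q"
  shows "\<exists>A. set_mset A \<subseteq> Irr ord \<and> prod_mset A = q"
  using assms
proof (induction "total_deg q" arbitrary: q rule: less_induct)
  case less
  have nz: "q \<noteq> 0" using less.prems by (simp add: monic_def)
  show ?case
  proof (cases "q dvd 1")
    case True
    then show ?thesis using monic_unit[OF less.prems] by (intro exI[of _ "{#}"]) simp
  next
    case False
    then obtain f0 where f0: "irreducible f0" "f0 dvd q"
      using irreducible_divisor_exists nz by blast
    then have "f0 \<noteq> 0" by auto
    then obtain c where c: "c \<noteq> 0" "monic ord (Const c * f0)"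
      using monic_associate_exists by blast
    let ?f = "Const c * f0"
    have unit: "Const c * Const (inverse c) = (1 :: ('m, 'k) mpoly)"
      using c by (simp add: is_hom_mult[OF is_hom_Const, symmetric] is_hom_one[OF is_hom_Const])
    then have u: "Const c dvd (1 :: ('m, 'k) mpoly)" by (metis dvdI)
    have "irreducible ?f"
    proof (rule irreducibleI)
      show "?f \<noteq> 0" using c by (auto simp: monic_def)
      show "\<not> ?f dvd 1"
        using irreducible_not_unit[OF f0(1)] dvd_trans[OF dvd_triv_right] by blast
      fix a b assume "?f = a * b"
      then have "Const (inverse c) * ?f = (Const (inverse c) * a) * b" by (simp add: mult_ac)
      moreover have "Const (inverse c) * ?f = f0"
        using unit by (metis mult.assoc mult.commute mult_1)
      ultimately have "f0 = (Const (inverse c) * a) * b" by simp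
      from irreducibleD[OF f0(1) this] show "a dvd 1 \<or> b dvd 1"
        using dvd_trans[OF dvd_triv_right] by blast
    qed
    with c have f: "?f \<in> Irr ord" by (simp add: Irr_def)
    have "?f dvd q" using mult_dvd_mono[OF u f0(2)] by simp
    then obtain r where r: "q = ?f * r" by auto
    have "monic ord r" using monic_multD[of ?f r] c r less.prems by simp
    moreover have "total_deg r < total_deg q"
    proof -
      have "total_deg q = total_deg ?f + total_deg r"
        unfolding r using nz r by (intro total_deg_mult) auto
      moreover have "total_deg ?f \<noteq> 0"
        using Irr_not_unit[OF f] Irr_nonzero[OF f] is_unit_iff_total_deg by blast
      ultimately show ?thesis by simp
    qed
    ultimately obtain A where "set_mset A \<subseteq> Irr ord" "prod_mset A = r"
      using less.hyps[of r] by blast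
    with f r show ?thesis by (intro exI[of _ "add_mset ?f A"]) simp
  qed
qed

section \<open>The multiset of monic irreducible factors under products and translations\<close>

lemma factors_eqI: "set_mset A \<subseteq> Irr ord \<Longrightarrow> prod_mset A = q \<Longrightarrow> factors ord q = A"
  unfolding factors_def by (rule the_equality) (auto intro: Irr_factorization_unique)

lemma factors_monic:
  assumes "monic ord q"
  shows factors_in_Irr: "set_mset (factors ord q) \<subseteq> Irr ord" and prod_factors: "prod_mset (factors ord q) = q"
proof -
  obtain A where "set_mset A \<subseteq> Irr ord" "prod_mset A = q"
    using Irr_factorization_exists[OF assms] by blast
  moreover from this have "factors ord q = A" by (rule factors_eqI)
  ultimately show "set_mset (factors ord q) \<subseteq> Irr ord" "prod_mset (factors ord q) = q" by simp_all
qed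

lemma monic_prod_mset: "set_mset A \<subseteq> Irr ord \<Longrightarrow> monic ord (prod_mset A)"
  for A :: "('m, 'k::field) mpoly multiset"
  by (induction A) (auto simp: Irr_def monic_mult)

lemma factors_one [simp]: "factors ord 1 = {#}"
  by (rule factors_eqI) simp_all

lemma factors_mult:
  "monic ord a \<Longrightarrow> monic ord b \<Longrightarrow> factors ord (a * b) = factors ord a + factors ord b"
  by (rule factors_eqI) (simp_all add: factors_monic)

lemma monic_prod: "(\<And>x. x \<in> S \<Longrightarrow> monic ord (f x)) \<Longrightarrow> monic ord (prod f S)"
  for f :: "'i \<Rightarrow> ('m, 'k::idom) mpoly"
  by (induction S rule: infinite_finite_induct) (auto intro: monic_mult)

lemma factors_prod:
  "(\<And>x. x \<in> S \<Longrightarrow> monic ord (f x)) \<Longrightarrow> factors ord (prod f S) = (\<Sum>x\<in>S. factors ord (f x))"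
  by (induction S rule: infinite_finite_induct) (simp_all add: factors_mult monic_prod)

lemma in_factors_iff:
  assumes "monic ord q" "f \<in> Irr ord"
  shows "f \<in># factors ord q \<longleftrightarrow> f dvd q"
  using Irr_dvd_prod_mset[OF assms(2) factors_in_Irr[OF assms(1)]]
    dvd_prod_mset[of f "factors ord q"] prod_factors[OF assms(1)] by auto

lemma Irr_shift: "f \<in> Irr ord \<Longrightarrow> shift f c \<in> Irr ord"
  for f :: "('m, 'k::field) mpoly"
  by (simp add: Irr_def monic_shift irreducible_shift)

lemma shift_prod_mset: "shift (prod_mset A) c = prod_mset (image_mset (\<lambda>f. shift f c) A)"
  for A :: "('m, 'k::field) mpoly multiset"
  by (induction A) (simp_all add: shift_mult)

lemma factors_shift:
  assumes "monic ord q"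
  shows "factors ord (shift q c) = image_mset (\<lambda>f. shift f c) (factors ord q)"
  using factors_in_Irr[OF assms] Irr_shift
  by (intro factors_eqI) (auto simp: shift_prod_mset[symmetric] prod_factors[OF assms])

lemma factors_irr_part:
  "monic ord q \<Longrightarrow> factors ord (irr_part ord T q) = filter_mset (\<lambda>f. f \<in> T) (factors ord q)"
  using factors_in_Irr[of q] by (intro factors_eqI) (auto simp: irr_part_def)

lemma monic_irr_part: "monic ord q \<Longrightarrow> monic ord (irr_part ord T q)"
  unfolding irr_part_def using factors_in_Irr[of q] by (intro monic_prod_mset) auto

lemma irr_part_mult:
  "monic ord a \<Longrightarrow> monic ord b \<Longrightarrow> irr_part ord T (a * b) = irr_part ord T a * irr_part ord T b"
  by (simp add: irr_part_def factors_mult)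

text \<open>Translation is injective on monic irreducibles and carries the factors of
  \<open>q\<close> to those of its translate; the selecting set must move along.\<close>

lemma irr_part_shift:
  assumes "monic ord q"
  shows "irr_part ord ((\<lambda>f. shift f c) ` T) (shift q c) = shift (irr_part ord T q) c"
proof -
  have "(shift f c \<in> (\<lambda>f. shift f c) ` T) = (f \<in> T)" for f
    by (auto simp: shift_inj)
  then show ?thesis
    by (simp add: irr_part_def factors_shift[OF assms] shift_prod_mset filter_mset_image_mset comp_def)
qed

end

section \<open>Orbits\<close>

lemma int_iterate_shift:
  fixes S :: "('m::finite, 'k::field) mpoly \<Rightarrow> ('m, 'k) mpoly"
  assumes S: "\<And>q. S q = shift q v"
  shows "int_iterate S a q = shift q (of_int a *s v)"
proof -
  have inv: "inv S q = shift q (- v)" for q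
    by (rule inv_f_eq) (simp_all add: S inj_def shift_inj shift_shift)
  have pow: "(F ^^ n) q = shift q (of_nat n *s w)"
    if "\<And>q. F q = shift q w" for F :: "('m, 'k) mpoly \<Rightarrow> ('m, 'k) mpoly" and n w
    by (induction n) (simp_all add: that shift_shift add.commute)
  show ?thesis
  proof (cases "a \<ge> 0")
    case True
    then show ?thesis
      unfolding int_iterate_def using pow[OF S, of "nat a"] by simp
  next
    case False
    then have "int_iterate S a q = shift q (of_nat (nat (- a)) *s (- v))"
      unfolding int_iterate_def using pow[OF inv, of "nat (- a)"] by simp
    also have "of_nat (nat (- a)) *s (- v) = of_int a *s v"
      using False by (simp add: vec_eq_iff)
    finally show ?thesis .
  qed
qed

text \<open>The map from integer vectors to the group generated by the columns of \<alpha>. It is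
  additive but need not be injective, for instance in positive characteristic.\<close>

definition lattice_vec :: "'k::field ^ 'n::finite ^ 'm \<Rightarrow> int ^ 'n \<Rightarrow> 'k ^ 'm" where
  "lattice_vec \<alpha> a = (\<Sum>i\<in>UNIV. of_int (a $ i) *s column i \<alpha>)"

lemma lattice_vec_add: "lattice_vec \<alpha> (a + b) = lattice_vec \<alpha> a + lattice_vec \<alpha> b"
  by (simp add: lattice_vec_def sum.distrib)

lemma lattice_vec_uminus: "lattice_vec \<alpha> (- a) = - lattice_vec \<alpha> a"
  by (simp add: lattice_vec_def sum_negf[symmetric] vec_eq_iff)

lemma lattice_vec_0: "lattice_vec \<alpha> 0 = 0"
  by (simp add: lattice_vec_def vec_eq_iff)

lemma lattice_vec_axis: "lattice_vec \<alpha> (axis i 1) = column i \<alpha>"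
proof -
  have "lattice_vec \<alpha> (axis i 1) = (\<Sum>j\<in>UNIV. if j = i then column j \<alpha> else 0)"
    unfolding lattice_vec_def by (rule sum.cong) (auto simp: axis_def vec_eq_iff)
  then show ?thesis by simp
qed

lemma sigma_eq_shift: "sigma \<alpha> i q = shift q (- column i \<alpha>)"
  by (simp add: sigma_def shift_def column_def is_hom_uminus[OF is_hom_Const])

lemma sigma_half_eq_shift: "sigma_half \<alpha> i q = shift q (- ((1/2) *s column i \<alpha>))"
  by (simp add: sigma_half_def shift_def column_def is_hom_uminus[OF is_hom_Const])

text \<open>Composing translations adds their vectors, so the ordered composition collapses to one
  translation. The sign stems from \<open>sigma\<close>, which subtracts the column.\<close>

lemma act_eq_shift: "act \<alpha> a q = shift q (- lattice_vec \<alpha> a)"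
proof -
  have "foldr (\<lambda>i g. int_iterate (sigma \<alpha> i) (a $ i) \<circ> g) xs id q =
      shift q (- (\<Sum>i\<in>set xs. of_int (a $ i) *s column i \<alpha>))" if "distinct xs" for xs
    using that
  proof (induction xs)
    case (Cons i xs)
    then show ?case
      by (simp add: int_iterate_shift[OF sigma_eq_shift] shift_shift algebra_simps)
  qed simp
  then show ?thesis
    by (simp add: act_def lattice_vec_def)
qed

definition shift_orbit ::
  "'k::field ^ 'n::finite ^ 'm::finite \<Rightarrow> ('m, 'k) mpoly \<Rightarrow> ('m, 'k) mpoly set" where
  "shift_orbit \<alpha> q = {shift q (lattice_vec \<alpha> a) | a. True}"

text \<open>The sign in \<open>act_eq_shift\<close> disappears because \<open>- a\<close> runs
  through all integer vectors together with \<open>a\<close>.\<close>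

lemma Irr_orbits_eq: "Irr_orbits ord \<alpha> = shift_orbit \<alpha> ` Irr ord"
proof -
  have "{act \<alpha> a q | a. True} = shift_orbit \<alpha> q" for q
    unfolding shift_orbit_def act_eq_shift
    by (auto simp flip: lattice_vec_uminus) (metis minus_minus)
  then show ?thesis by (auto simp: Irr_orbits_def)
qed

lemma shift_orbit_refl: "q \<in> shift_orbit \<alpha> q"
  unfolding shift_orbit_def using lattice_vec_0[of \<alpha>] by (auto intro: exI[of _ 0])

lemma shift_orbit_shift: "shift_orbit \<alpha> (shift q (lattice_vec \<alpha> a)) = shift_orbit \<alpha> q"
proof -
  have sub: "shift_orbit \<alpha> (shift q (lattice_vec \<alpha> a)) \<subseteq> shift_orbit \<alpha> q" for q a
    unfolding shift_orbit_def by (auto simp: shift_shift simp flip: lattice_vec_add)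
  from sub[of "shift q (lattice_vec \<alpha> a)" "- a"] show ?thesis
    by (intro equalityI sub) (simp add: shift_shift lattice_vec_uminus)
qed

lemma shift_orbit_eq: "f \<in> shift_orbit \<alpha> q \<Longrightarrow> shift_orbit \<alpha> f = shift_orbit \<alpha> q"
  by (auto simp: shift_orbit_def[of _ q] shift_orbit_shift)

lemma Irr_orbits_member:
  "\<O> \<in> Irr_orbits ord \<alpha> \<Longrightarrow> f \<in> \<O> \<Longrightarrow> \<O> = shift_orbit \<alpha> f"
  by (auto simp: Irr_orbits_eq shift_orbit_eq)

text \<open>A translate of an orbit depends on the vector only modulo the lattice. The converse
  inclusion is the proved one with \<open>- a\<close>.\<close>

lemma shift_image_orbit:
  assumes "\<O> \<in> Irr_orbits ord \<alpha>"
  shows "(\<lambda>q. shift q (v + lattice_vec \<alpha> a)) ` \<O> = (\<lambda>q. shift q v) ` \<O>"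
proof -
  have sub: "(\<lambda>q. shift q (v + lattice_vec \<alpha> a)) ` \<O> \<subseteq> (\<lambda>q. shift q v) ` \<O>" for v a
  proof
    fix f assume "f \<in> (\<lambda>q. shift q (v + lattice_vec \<alpha> a)) ` \<O>"
    then obtain q where q: "q \<in> \<O>" "f = shift q (v + lattice_vec \<alpha> a)" by blast
    have "shift q (lattice_vec \<alpha> a) \<in> \<O>"
      using Irr_orbits_member[OF assms q(1)] by (auto simp: shift_orbit_def)
    moreover have "f = shift (shift q (lattice_vec \<alpha> a)) v"
      using q(2) by (simp add: shift_shift add.commute)
    ultimately show "f \<in> (\<lambda>q. shift q v) ` \<O>" by blast
  qed
  from sub[of "v + lattice_vec \<alpha> a" "- a"] show ?thesis
    by (intro equalityI sub) (simp add: lattice_vec_uminus)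
qed

section \<open>The orbital components of a solution\<close>

definition component ::
  "'m monom rel \<Rightarrow> 'k::field ^ 'n::finite ^ 'm \<Rightarrow> ('m::finite, 'k) mpoly set \<Rightarrow>
    ('m, 'k) mpoly ^ 'n \<Rightarrow> ('m, 'k) mpoly ^ 'n" where
  "component ord \<alpha> \<O> p = (\<chi> i. irr_part ord (sigma_half \<alpha> i ` \<O>) (p $ i))"

text \<open>Leaving out the orbits with component 1 makes the index set finite and matches the
  condition \<open>q \<noteq> 1\<close> of the theorem.\<close>

definition support ::
  "'m monom rel \<Rightarrow> 'k::field ^ 'n::{finite,linorder} ^ 'm \<Rightarrow>
    ('m::finite, 'k) mpoly ^ 'n::{finite,linorder} \<Rightarrow> ('m, 'k) mpoly set set" where
  "support ord \<alpha> p = {\<O> \<in> Irr_orbits ord \<alpha>. component ord \<alpha> \<O> p \<noteq> 1}"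

lemma prod_index: "prod f S $ i = (\<Prod>x\<in>S. f x $ i)"
  for f :: "'i \<Rightarrow> 'b::comm_ring_1 ^ 'l::finite"
  by (induction S rule: infinite_finite_induct) simp_all

context
  fixes ord :: "'m::{finite,linorder} monom rel"
    and \<alpha> :: "'k::field ^ 'n::{finite,linorder} ^ 'm::{finite,linorder}"
  assumes ord: "monomial_order ord"
    and two: "(2 :: 'k) \<noteq> 0"
begin

abbreviation half where
  "half j \<equiv> (1/2) *s column j \<alpha>"

text \<open>The characteristic enters here: if 2 were 0, then \<open>1/2\<close> would be 0 as
  well.\<close>

lemma half_add_half: "half j + half j = lattice_vec \<alpha> (axis j 1)"
proof -
  have "1/2 + 1/2 = (1 :: 'k)" using two by (simp flip: add_divide_distrib)
  then show ?thesis
    by (simp only: vector_sadd_rdistrib[symmetric] lattice_vec_axis vector_smult_lid)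
qed

lemma sigma_half_image: "sigma_half \<alpha> i ` \<O> = (\<lambda>q. shift q (- half i)) ` \<O>"
  by (simp add: sigma_half_eq_shift)

text \<open>The orbit can be read off from any element of its half translate, so for fixed
  \<open>i\<close> distinct orbits have disjoint half translates.\<close>

lemma sigma_half_image_unique:
  assumes "\<O> \<in> Irr_orbits ord \<alpha>" "f \<in> sigma_half \<alpha> i ` \<O>"
  shows "\<O> = shift_orbit \<alpha> (shift f (half i))"
proof -
  from assms(2) obtain q where "q \<in> \<O>" "f = shift q (- half i)"
    unfolding sigma_half_image by blast
  then show ?thesis
    using Irr_orbits_member[OF assms(1)] by (simp add: shift_shift)
qed

text \<open>The lattice term in \<open>w\<close> allows one target set to serve for several
  translations \<open>c\<close> of the same polynomial.\<close>

lemma part_orbit_shift: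
  assumes "\<O> \<in> Irr_orbits ord \<alpha>" "monic ord q" "w = - half i + c + lattice_vec \<alpha> a"
  shows "irr_part ord ((\<lambda>q. shift q w) ` \<O>) (shift q c) = shift (irr_part ord (sigma_half \<alpha> i ` \<O>) q) c"
proof -
  have "(\<lambda>q. shift q w) ` \<O> = (\<lambda>q. shift q (- half i + c)) ` \<O>"
    unfolding assms(3) by (rule shift_image_orbit[OF assms(1)])
  also have "\<dots> = (\<lambda>f. shift f c) ` sigma_half \<alpha> i ` \<O>"
    by (simp add: sigma_half_image image_image shift_shift)
  finally show ?thesis
    by (simp add: irr_part_shift[OF ord assms(2)])
qed

lemma monic_vec_component: "monic_vec ord p \<Longrightarrow> monic_vec ord (component ord \<alpha> \<O> p)"
  by (simp add: monic_vec_def component_def monic_irr_part[OF ord])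

lemma solution_component:
  assumes p: "monic_vec ord p" "solution \<alpha> p" and \<O>: "\<O> \<in> Irr_orbits ord \<alpha>"
  shows "solution \<alpha> (component ord \<alpha> \<O> p)"
proof -
  let ?P = "\<lambda>i. irr_part ord (sigma_half \<alpha> i ` \<O>) (p $ i)"
  have m: "monic ord (p $ i)" "monic ord (shift (p $ i) c)" for i c
    using p(1) monic_shift[OF ord] by (auto simp: monic_vec_def)
  note irr_part_shift = part_orbit_shift[OF \<O> m(1)]
  have eq1: "shift (p $ i) (- half j) * shift (p $ j) (- half i) =
      shift (p $ i) (half j) * shift (p $ j) (half i)" if "i \<noteq> j" for i j
    using p(2) that unfolding solution_def Let_def by blast
  have eq2: "shift (p $ k) (- half i - half j) * shift (p $ k) (half i + half j) =
      shift (p $ k) (- half i + half j) * shift (p $ k) (half i - half j)"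
    if "i \<noteq> j" "j \<noteq> k" "k \<noteq> i" for i j k
    using p(2) that unfolding solution_def Let_def by blast
  have "shift (?P i) (- half j) * shift (?P j) (- half i) =
      shift (?P i) (half j) * shift (?P j) (half i)" if "i \<noteq> j" for i j
  proof -
    \<comment> \<open>For a fixed set, \<open>irr_part\<close> is multiplicative on monic
      polynomials, so it is applied to both sides of the equation. The minus translates land in
      \<open>?W\<close> directly; for the plus translates a full column is subtracted, which
      explains the witnesses \<open>- axis j 1\<close> and \<open>- axis i 1\<close>.\<close>
    let ?W = "(\<lambda>q. shift q (- half i - half j)) ` \<O>"
    have "irr_part ord ?W (shift (p $ i) (- half j) * shift (p $ j) (- half i)) =
        irr_part ord ?W (shift (p $ i) (half j) * shift (p $ j) (half i))"
      by (simp only: eq1[OF that])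
    moreover have "irr_part ord ?W (shift (p $ i) (- half j)) = shift (?P i) (- half j)"
      by (rule irr_part_shift[where a = 0]) (simp add: lattice_vec_0)
    moreover have "irr_part ord ?W (shift (p $ j) (- half i)) = shift (?P j) (- half i)"
      by (rule irr_part_shift[where a = 0]) (simp add: lattice_vec_0)
    moreover have "irr_part ord ?W (shift (p $ i) (half j)) = shift (?P i) (half j)"
      by (rule irr_part_shift[where a = "- axis j 1"])
        (simp add: lattice_vec_uminus flip: half_add_half)
    moreover have "irr_part ord ?W (shift (p $ j) (half i)) = shift (?P j) (half i)"
      by (rule irr_part_shift[where a = "- axis i 1"])
        (simp add: lattice_vec_uminus flip: half_add_half)
    ultimately show ?thesis
      by (simp add: irr_part_mult[OF ord] m)
  qed
  moreover have "shift (?P k) (- half i - half j) * shift (?P k) (half i + half j) =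
      shift (?P k) (- half i + half j) * shift (?P k) (half i - half j)"
    if "i \<noteq> j" "j \<noteq> k" "k \<noteq> i" for i j k
  proof -
    \<comment> \<open>Now \<open>- half k\<close> comes from the class of the orbit in
      \<open>p $ k\<close>. Each plus sign at \<open>half i\<close> or \<open>half j\<close> is
      again turned into a minus by subtracting that column.\<close>
    let ?W = "(\<lambda>q. shift q (- half k - half i - half j)) ` \<O>"
    have "irr_part ord ?W (shift (p $ k) (- half i - half j) * shift (p $ k) (half i + half j)) =
        irr_part ord ?W (shift (p $ k) (- half i + half j) * shift (p $ k) (half i - half j))"
      by (simp only: eq2[OF that])
    moreover have "irr_part ord ?W (shift (p $ k) (- half i - half j)) = shift (?P k) (- half i - half j)"
      by (rule irr_part_shift[where a = 0]) (simp add: lattice_vec_0)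
    moreover have "irr_part ord ?W (shift (p $ k) (half i + half j)) = shift (?P k) (half i + half j)"
      by (rule irr_part_shift[where a = "- axis i 1 + - axis j 1"])
        (unfold lattice_vec_uminus lattice_vec_add half_add_half[symmetric], simp)
    moreover have "irr_part ord ?W (shift (p $ k) (- half i + half j)) = shift (?P k) (- half i + half j)"
      by (rule irr_part_shift[where a = "- axis j 1"])
        (simp add: lattice_vec_uminus flip: half_add_half)
    moreover have "irr_part ord ?W (shift (p $ k) (half i - half j)) = shift (?P k) (half i - half j)"
      by (rule irr_part_shift[where a = "- axis i 1"])
        (simp add: lattice_vec_uminus flip: half_add_half)
    ultimately show ?thesis
      by (simp add: irr_part_mult[OF ord] m)
  qed
  ultimately show ?thesis
    unfolding solution_def Let_def component_def vec_lambda_beta by blast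
qed

lemma orbital_component:
  assumes "monic_vec ord p"
  shows "orbital ord \<alpha> \<O> (component ord \<alpha> \<O> p)"
proof -
  have m: "monic ord (p $ i)" for i using assms by (simp add: monic_vec_def)
  have "f \<in> sigma_half \<alpha> i ` \<O>" if "f \<in> Irr ord" "f dvd component ord \<alpha> \<O> p $ i" for f i
  proof -
    have "f \<in># factors ord (irr_part ord (sigma_half \<alpha> i ` \<O>) (p $ i))"
      using that in_factors_iff[OF ord monic_irr_part[OF ord m] that(1)] by (simp add: component_def)
    then show ?thesis by (simp only: factors_irr_part[OF ord m] set_mset_filter mem_Collect_eq)
  qed
  then show ?thesis
    using monic_vec_component[OF assms] by (auto simp: orbital_def)
qed

lemma component_neq_1I:
  assumes "monic_vec ord p" "f \<in># factors ord (p $ i)" "f \<in> sigma_half \<alpha> i ` \<O>"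
  shows "component ord \<alpha> \<O> p \<noteq> 1"
proof
  assume "component ord \<alpha> \<O> p = 1"
  then have "component ord \<alpha> \<O> p $ i = 1" by simp
  then have "irr_part ord (sigma_half \<alpha> i ` \<O>) (p $ i) = 1"
    by (simp only: component_def vec_lambda_beta)
  then have "factors ord (irr_part ord (sigma_half \<alpha> i ` \<O>) (p $ i)) = {#}"
    by (simp add: factors_one[OF ord])
  moreover have "f \<in># factors ord (irr_part ord (sigma_half \<alpha> i ` \<O>) (p $ i))"
    using assms by (simp add: monic_vec_def factors_irr_part[OF ord])
  ultimately show False by simp
qed

lemma component_neq_1E:
  assumes "component ord \<alpha> \<O> p \<noteq> 1"
  obtains i f where "f \<in># factors ord (p $ i)" "f \<in> sigma_half \<alpha> i ` \<O>"
proof -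
  have "\<exists>i f. f \<in># factors ord (p $ i) \<and> f \<in> sigma_half \<alpha> i ` \<O>"
  proof (rule ccontr)
    assume "\<not> ?thesis"
    then have empty: "filter_mset (\<lambda>f. f \<in> sigma_half \<alpha> i ` \<O>) (factors ord (p $ i)) = {#}" for i
      by auto
    have "component ord \<alpha> \<O> p = 1"
      unfolding component_def irr_part_def empty by (simp add: vec_eq_iff)
    with assms show False by simp
  qed
  with that show ?thesis by blast
qed

text \<open>Each factor of an entry is claimed by exactly one orbit of the support. That orbit
  belongs to the support because the factor itself makes its component nontrivial.\<close>

lemma support_unique:
  assumes "monic_vec ord p" "f \<in># factors ord (p $ i)"
  shows "\<O> \<in> support ord \<alpha> p \<and> f \<in> sigma_half \<alpha> i ` \<O> \<longleftrightarrow> \<O> = shift_orbit \<alpha> (shift f (half i))"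
proof
  assume "\<O> \<in> support ord \<alpha> p \<and> f \<in> sigma_half \<alpha> i ` \<O>"
  then show "\<O> = shift_orbit \<alpha> (shift f (half i))"
    by (intro sigma_half_image_unique) (simp_all add: support_def)
next
  let ?q = "shift f (half i)"
  assume \<O>: "\<O> = shift_orbit \<alpha> ?q"
  have "f \<in> Irr ord"
    using assms factors_in_Irr[OF ord] by (auto simp: monic_vec_def)
  then have "\<O> \<in> Irr_orbits ord \<alpha>"
    unfolding \<O> Irr_orbits_eq by (intro imageI Irr_shift[OF ord])
  moreover have f: "f \<in> sigma_half \<alpha> i ` \<O>"
    unfolding sigma_half_image
    by (rule image_eqI[of _ _ ?q]) (simp_all add: \<O> shift_orbit_refl shift_shift)
  ultimately show "\<O> \<in> support ord \<alpha> p \<and> f \<in> sigma_half \<alpha> i ` \<O>"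
    using component_neq_1I[OF assms f] by (simp add: support_def)
qed

lemma finite_support:
  assumes "monic_vec ord p"
  shows "finite (support ord \<alpha> p)"
proof (rule finite_subset)
  show "support ord \<alpha> p \<subseteq>
      (\<Union>i. (\<lambda>f. shift_orbit \<alpha> (shift f (half i))) ` set_mset (factors ord (p $ i)))"
  proof
    fix \<O> assume \<O>: "\<O> \<in> support ord \<alpha> p"
    then obtain i f where "f \<in># factors ord (p $ i)" "f \<in> sigma_half \<alpha> i ` \<O>"
      using component_neq_1E unfolding support_def by blast
    with \<O> support_unique[OF assms this(1), of \<O>]
    show "\<O> \<in> (\<Union>i. (\<lambda>f. shift_orbit \<alpha> (shift f (half i))) ` set_mset (factors ord (p $ i)))"
      by blast
  qed
qed simp

lemma prod_components:
  assumes "monic_vec ord p"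
  shows "p = (\<Prod>\<O>\<in>support ord \<alpha> p. component ord \<alpha> \<O> p)"
proof -
  have "p $ i = (\<Prod>\<O>\<in>support ord \<alpha> p. component ord \<alpha> \<O> p) $ i" for i
  proof -
    \<comment> \<open>The multiset varies while the support stays that of \<open>p\<close>. Adding
      one factor changes the product of exactly one orbit.\<close>
    have "(\<Prod>\<O>\<in>support ord \<alpha> p. prod_mset (filter_mset (\<lambda>f. f \<in> sigma_half \<alpha> i ` \<O>) A)) = prod_mset A"
      if "set_mset A \<subseteq> set_mset (factors ord (p $ i))" for A
      using that
    proof (induction A)
      case (add f A)
      then have f: "f \<in># factors ord (p $ i)" by simp
      let ?\<O> = "shift_orbit \<alpha> (shift f (half i))"
      have "(\<Prod>\<O>\<in>support ord \<alpha> p. prod_mset (filter_mset (\<lambda>f. f \<in> sigma_half \<alpha> i ` \<O>) (add_mset f A))) =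
          (\<Prod>\<O>\<in>support ord \<alpha> p. (if \<O> = ?\<O> then f else 1) *
            prod_mset (filter_mset (\<lambda>f. f \<in> sigma_half \<alpha> i ` \<O>) A))"
        using support_unique[OF assms f] by (intro prod.cong refl) auto
      also have "\<dots> = f * prod_mset A"
        using add finite_support[OF assms] support_unique[OF assms f, of ?\<O>]
        by (simp add: prod.distrib)
      finally show ?case by simp
    qed simp
    from this[of "factors ord (p $ i)"] show ?thesis
      using assms by (simp add: prod_index component_def irr_part_def monic_vec_def prod_factors[OF ord])
  qed
  then show ?thesis by (simp add: vec_eq_iff)
qed

text \<open>The factors of an entry of \<open>p\<close> are the sum of the factors of the entries of
  the members of \<open>S\<close>. Orbitality puts each summand into the class of its own orbit, and
  no orbit occurs twice, so filtering by an orbit returns a single summand: the members of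
  \<open>S\<close> are components of \<open>p\<close>.\<close>

lemma orbital_decomposition_unique:
  assumes S: "finite S" "S \<subseteq> Irr_orbits ord \<alpha> \<times> UNIV" "p = (\<Prod>x\<in>S. snd x)"
    and monic: "\<And>x. x \<in> S \<Longrightarrow> monic_vec ord (snd x)"
    and orbital: "\<And>x. x \<in> S \<Longrightarrow> orbital ord \<alpha> (fst x) (snd x)"
    and inj: "inj_on fst S"
    and nontrivial: "\<And>x. x \<in> S \<Longrightarrow> snd x \<noteq> 1"
  shows "S = (\<lambda>\<O>. (\<O>, component ord \<alpha> \<O> p)) ` support ord \<alpha> p"
proof -
  have m: "monic ord (snd x $ i)" if "x \<in> S" for x i
    using monic[OF that] by (simp add: monic_vec_def)
  have factors: "factors ord (p $ i) = (\<Sum>x\<in>S. factors ord (snd x $ i))" for i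
    unfolding S(3) prod_index by (rule factors_prod[OF ord m])
  have filter_snd: "filter_mset (\<lambda>f. f \<in> sigma_half \<alpha> i ` \<O>) (factors ord (snd x $ i)) =
      (if \<O> = fst x then factors ord (snd x $ i) else {#})"
    if x: "x \<in> S" and \<O>: "\<O> \<in> Irr_orbits ord \<alpha>" for x \<O> i
  proof -
    have in_fst: "f \<in> sigma_half \<alpha> i ` fst x" if "f \<in># factors ord (snd x $ i)" for f
    proof -
      have "f \<in> Irr ord" using that factors_in_Irr[OF ord m[OF x]] by blast
      then show ?thesis
        using that orbital[OF x] in_factors_iff[OF ord m[OF x]] by (auto simp: orbital_def)
    qed
    have fst: "fst x \<in> Irr_orbits ord \<alpha>" using x S(2) by auto
    show ?thesis
    proof (cases "\<O> = fst x")
      case True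
      then show ?thesis using in_fst by (simp add: filter_mset_eq_conv)
    next
      case False
      then have "f \<notin> sigma_half \<alpha> i ` \<O>" if "f \<in># factors ord (snd x $ i)" for f
        using sigma_half_image_unique[OF fst in_fst[OF that]] sigma_half_image_unique[OF \<O>] by blast
      with False show ?thesis by auto
    qed
  qed
  have filter: "filter_mset (\<lambda>f. f \<in> sigma_half \<alpha> i ` \<O>) (factors ord (p $ i)) =
      (\<Sum>x\<in>S. if \<O> = fst x then factors ord (snd x $ i) else {#})"
    if "\<O> \<in> Irr_orbits ord \<alpha>" for \<O> i
  proof -
    have "filter_mset P (\<Sum>x\<in>S. F x) = (\<Sum>x\<in>S. filter_mset P (F x))" for P and F :: "_ \<Rightarrow> ('m, 'k) mpoly multiset"
      using S(1) by (induction S) simp_all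
    with that filter_snd show ?thesis by (simp add: factors)
  qed
  have comp: "component ord \<alpha> (fst x) p = snd x" if x: "x \<in> S" for x
  proof -
    have "(\<Sum>y\<in>S. if fst x = fst y then factors ord (snd y $ i) else {#}) =
        (\<Sum>y\<in>S. if y = x then factors ord (snd x $ i) else {#})" for i
      by (rule sum.cong) (use x inj in \<open>auto dest: inj_onD\<close>)
    moreover have "fst x \<in> Irr_orbits ord \<alpha>" using x S(2) by auto
    ultimately show ?thesis
      using x S(1) by (simp add: vec_eq_iff component_def irr_part_def filter prod_factors[OF ord m])
  qed
  show ?thesis
  proof (intro equalityI subsetI)
    fix x assume x: "x \<in> S"
    then have "fst x \<in> support ord \<alpha> p"
      using S(2) nontrivial[OF x] comp[OF x] by (auto simp: support_def)
    moreover have "x = (fst x, component ord \<alpha> (fst x) p)" using comp[OF x] by simp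
    ultimately show "x \<in> (\<lambda>\<O>. (\<O>, component ord \<alpha> \<O> p)) ` support ord \<alpha> p" by blast
  next
    fix x assume "x \<in> (\<lambda>\<O>. (\<O>, component ord \<alpha> \<O> p)) ` support ord \<alpha> p"
    then obtain \<O> where \<O>: "\<O> \<in> Irr_orbits ord \<alpha>" "component ord \<alpha> \<O> p \<noteq> 1" "x = (\<O>, component ord \<alpha> \<O> p)"
      by (auto simp: support_def)
    \<comment> \<open>An orbit missing from \<open>S\<close> would receive no factors at all, and
      its component would be 1.\<close>
    have "\<exists>y\<in>S. fst y = \<O>"
    proof (rule ccontr)
      assume "\<not> ?thesis"
      then have "(\<Sum>y\<in>S. if \<O> = fst y then factors ord (snd y $ i) else {#}) = {#}" for i
        by (intro sum.neutral) auto
      then have "component ord \<alpha> \<O> p = 1"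
        by (simp add: vec_eq_iff component_def irr_part_def filter[OF \<O>(1)])
      with \<O>(2) show False by simp
    qed
    then obtain y where y: "y \<in> S" "fst y = \<O>" by blast
    have "x = y" using \<O>(3) comp[OF y(1)] y(2) by (simp add: prod_eq_iff)
    then show "x \<in> S" using y by simp
  qed
qed

end

theorem theorem3p2:
  fixes ord :: "'m::{finite,linorder} monom rel"
    and \<alpha> :: "'k::field ^ 'n::{finite,linorder} ^ 'm::{finite,linorder}"
    and p :: "('m, 'k) mpoly ^ 'n::{finite,linorder}"
  assumes "monomial_order ord"
    and "CHAR('k) \<noteq> 2"
    and "monic_vec ord p"
    and "solution \<alpha> p"
  shows "\<exists>!S. finite S \<and> S \<subseteq> Irr_orbits ord \<alpha> \<times> (UNIV :: (('m, 'k) mpoly ^ 'n::{finite,linorder}) set) \<and>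
    p = (\<Prod>(\<O>, q)\<in>S. q) \<and>
    (\<forall>(\<O>, q)\<in>S. monic_vec ord q \<and> solution \<alpha> q) \<and>
    (\<forall>(\<O>, q)\<in>S. orbital ord \<alpha> \<O> q) \<and>
    (\<forall>x\<in>S. \<forall>y\<in>S. x \<noteq> y \<longrightarrow> fst x \<noteq> fst y) \<and>
    (\<forall>(\<O>, q)\<in>S. q \<noteq> 1)"
proof -
  have two: "(2 :: 'k) \<noteq> 0"
  proof
    assume "(2 :: 'k) = 0"
    then have "of_nat 2 = (0 :: 'k)" by simp
    then have "CHAR('k) dvd 2" by (simp only: of_nat_eq_0_iff_char_dvd)
    \<comment> \<open>The only divisors of 2 are 1 and 2, and characteristic 1 would mean
      \<open>1 = 0\<close>.\<close>
    then have "CHAR('k) = 1"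
      using assms(2) two_is_prime_nat by (auto simp: prime_nat_iff)
    then show False by simp
  qed
  let ?D = "support ord \<alpha> p" and ?P = "\<lambda>\<O>. component ord \<alpha> \<O> p"
  have snd_prod: "(\<Prod>(\<O>, q)\<in>S. q) = prod snd S"
    for S :: "(('m, 'k) mpoly set \<times> (('m, 'k) mpoly ^ 'n::{finite,linorder})) set"
    by (intro prod.cong refl) auto
  show ?thesis
  proof (rule ex1I[of _ "(\<lambda>\<O>. (\<O>, ?P \<O>)) ` ?D"], goal_cases)
    case 1
    have reindex: "prod snd ((\<lambda>\<O>. (\<O>, ?P \<O>)) ` ?D) = (\<Prod>\<O>\<in>?D. ?P \<O>)"
      by (subst prod.reindex) (auto simp: inj_on_def)
    have prod: "p = (\<Prod>(\<O>, q)\<in>(\<lambda>\<O>. (\<O>, ?P \<O>)) ` ?D. q)"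
      unfolding snd_prod reindex by (rule prod_components[OF assms(1) two assms(3)])
    show ?case
      by (intro conjI prod) (use finite_support[OF assms(1) two assms(3), of \<alpha>]
        monic_vec_component[OF assms(1) two assms(3), of \<alpha>]
        solution_component[OF assms(1) two assms(3,4)]
        orbital_component[OF assms(1) two assms(3), of \<alpha>]
        in \<open>auto simp: support_def\<close>)
  next
    case (2 S)
    then show ?case
      unfolding snd_prod
      by (intro orbital_decomposition_unique[OF assms(1) two]) (auto simp: inj_on_def)
  qed
qed

end
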